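(* Suppose the points $\mathsf U^N=\{\mu_{(1)},\dots,\mu_{(N)}\}\subset\mathbb{R}^q$, $\mu_{(i)}=\mu(X_i)$, are i.i.d. from a distribution $\mathbb{P}_{\alpha,\nu}$ on $\mathbb{R}^q$ satisfying the $(\alpha,\nu)$-good neighborhood property for distributions (see context) with respect to the true cluster labelling $l$ with values in $\{C_1,\dots,C_k\}$. Assume: (1) either $\{\mu_a\}$ and $\{\widehat\mu_a\}$ are contained in a Donsker class, or $\{\widehat\mu_a\}$ is constructed from a separate independent sample of the same size; (2) $\|\mu\|_2,\|\widehat\mu\|_2\le B$ almost surely for some finite constant $B$; (3) $\mathbb{P}_{\alpha,\nu}$ has a bounded Lebesgue density. Let $\gamma=\sum_{a\in\mathcal A}\|\widehat\mu_a-\mu_a\|_\infty$. Then there is a constant $c>0$, not depending on $N,n,\delta,\delta_N,\alpha,\nu,\gamma$, such that the following holds for all $\delta,\delta_N\in(0,1)$. Define $$\alpha'=\alpha+c\sqrt{\tfrac1N\log\tfrac1{\delta_N}},\qquad \nu'=\nu+c\sqrt{\tfrac1N\log\tfrac1{\delta_N}},\qquad \varepsilon=c\left(\gamma+\tfrac1N\log\tfrac{1}{\delta_N}+\sqrt{\tfrac{\gamma}{N}\log\tfrac1\gamma}\right)$$ (the last square root being read as $0$ if $\gamma=0$ or $\gamma\ge1$). Let $\mathsf U^n\subset\mathsf U^N$ be a random subset of size $$n=\Theta\left(\frac{1}{\min(\alpha'+\varepsilon,\nu')}\log\frac{1}{\delta\min(\alpha'+\varepsilon,\nu')}\right),\qquad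 n< N,$$ and let $\widehat{\mathsf U}^n$ be the set of corresponding estimates $\widehat\mu_{(i)}$. Then with probability at least $1-\delta-2\delta_N$: as long as the smallest target cluster has size greater than $12(\nu'+\alpha'+\varepsilon)N$, the inductive robust hierarchical clustering algorithm run on $\widehat{\mathsf U}^n$ with the Euclidean distance produces a hierarchy with a pruning that has error at most $\nu'+\delta$ with respect to the true target clustering (of all $N$ points, where the $i$-th point carries the label $l(\mu_{(i)})$).
   Context: Setting: covariates $X_1,\dots,X_N$ are i.i.d. in $\mathcal X$; treatments $\mathcal A=\{1,\dots,q\}$; $\mu_a(x)=\mathbb{E}(Y\mid X=x,A=a)$ are outcome regression functions, $\mu=(\mu_1,\dots,\mu_q)^\top$; $\widehat\mu_a$ are estimators of $\mu_a$, $\widehat\mu=(\widehat\mu_1,\dots,\widehat\mu_q)^\top$; $\mu_{(i)}=\mu(X_i)$, $\widehat\mu_{(i)}=\widehat\mu(X_i)$; $\|f\|_\infty=\sup_{x\in\mathcal X}|f(x)|$. $\mathbb{B}(x,r)$ is the open Euclidean ball in $\mathbb{R}^q$. Every point $m\in\mathbb{R}^q$ has a true label $l(m)\in\{C_1,\dots,C_k\}$, and $C(m)$ denotes the cluster with label $l(m)$. Target cluster sizes are counted among the $N$ points. Good neighborhood property for distributions. For $m'\in\mathbb{R}^q$ let $\mathbb{C}(m')=\{m: C(m)=C(m')\}$. A distribution $\mathbb{P}_{\alpha,\nu}$ satisfies the $(\alpha,\nu)$-good neighborhood property if $\mathbb{P}_{\alpha,\nu}=(1-\nu)\mathbb{P}_\alpha+\nu\,\mathbb{P}_{\mathrm{noise}}$,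 where $\mathbb{P}_{\mathrm{noise}}$ is some probability distribution and $\mathbb{P}_\alpha$ is a probability distribution such that, for all $m'$, with $r_{m'}=\inf\{r:\mathbb{P}_\alpha(\mathbb{B}(m',r))=\mathbb{P}_\alpha(\mathbb{C}(m'))\}$, $$\mathbb{P}_\alpha\{\mathbb{B}(m',r_{m'})\setminus\mathbb{C}(m')\}\le\alpha .$$ Good neighborhood property for a finite clustering problem. For a finite (indexed) data set $\mathsf U$ of $N$ points with labels, a dissimilarity $d$ satisfies the $(a,v)$-good neighborhood property if there is $\mathsf U'\subset\mathsf U$ of size at least $(1-v)N$ such that for every $u\in\mathsf U'$, all but at most $aN$ of its $n_{C(u)\cap\mathsf U'}$ nearest neighbors in $\mathsf U'$ belong to the cluster $C(u)$, where $n_{C(u)\cap\mathsf U'}$ is the number of points of $\mathsf U'$ in the cluster of $u$. Algorithm. "The inductive robust hierarchical clustering algorithm" is Algorithm 2 of Balcan, Liang and Gupta (Robust hierarchical clustering, 2014). It takes a uniformly random subset of size $n$ of an $N$-point data set, together with a symmetric dissimilarity, builds a hierarchy (tree of nested clusters) over this subset and thereby implicitly a hierarchy over the entire data set. A pruning of a hierarchy is a partition of the data set into nodes of the tree. The error of a clustering with respect to a target clustering is the fraction of the $N$ points that are misclassified under the best matching of the cluster names. The algorithm may be taken as any procedure with the following known guarantee (Theorem 11 of that paper): if the dissimilarity satisfies the $(a,v)$-good neighborhood property for the labelled data set and the smallest target cluster has size greater than $12(v+a)N$, then with $n=\Theta\left(\frac{1}{\min(a,v)}\log\frac{1}{\delta\min(a,v)}\right)$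 (the same $\Theta$ as in the theorem) it produces, with probability at least $1-\delta$, a hierarchy with a pruning of error at most $v+\delta$ with respect to the target clustering. *)

theory Defs
  imports "HOL-Probability.Probability"
begin

definition outer_expectation :: "'a measure \<Rightarrow> ('a \<Rightarrow> real) \<Rightarrow> real" where
  "outer_expectation Q h = (INF U\<in>{U. integrable Q U \<and> (\<forall>x\<in>space Q. h x \<le> U x)}. integral\<^sup>L Q U)"

definition empirical_process :: "'x measure \<Rightarrow> nat \<Rightarrow> (nat \<Rightarrow> 'x) \<Rightarrow> ('x \<Rightarrow> real) \<Rightarrow> real" where
  "empirical_process Q n x f = sqrt n * ((\<Sum>i<n. f (x i)) / n - integral\<^sup>L Q f)"

text \<open>The space \<open>l\<^sup>\<infinity>(F)\<close> of bounded real functions on a class \<open>F\<close>, with the uniform norm, is realised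
  inside the bounded continuous functions on the discrete space of all functions, as those
  vanishing off \<open>F\<close>.\<close>

type_synonym 'x linf = "('x \<Rightarrow> real) discrete \<Rightarrow>\<^sub>C real"

definition to_linf :: "('x \<Rightarrow> real) set \<Rightarrow> (('x \<Rightarrow> real) \<Rightarrow> real) \<Rightarrow> 'x linf" where
  "to_linf F g = Bcontfun (\<lambda>t. if of_discrete t \<in> F then g (of_discrete t) else 0)"

text \<open>Weak convergence of the empirical process in \<open>l\<^sup>\<infinity>(F)\<close> to a tight Borel law, in the sense of
  Hoffmann-Joergensen; the observations are the coordinates of the infinite product space. The
  third condition is the usual one that makes the empirical process take values in \<open>l\<^sup>\<infinity>(F)\<close>.
  The limit is automatically the Brownian bridge, by convergence of the marginals.\<close>

definition Donsker :: "'x measure \<Rightarrow> ('x \<Rightarrow> real) set \<Rightarrow> bool" where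
  "Donsker Q F \<longleftrightarrow>
     (\<forall>f\<in>F. f \<in> borel_measurable Q) \<and>
     (\<forall>f\<in>F. integrable Q (\<lambda>x. (f x)\<^sup>2)) \<and>
     (\<forall>x\<in>space Q. bounded ((\<lambda>f. f x - integral\<^sup>L Q f) ` F)) \<and>
     (\<exists>G :: 'x linf measure.
        prob_space G \<and> sets G = sets borel \<and>
        (\<forall>e>0. \<exists>K. compact K \<and> measure G K \<ge> 1 - e) \<and>
        (\<forall>h :: 'x linf \<Rightarrow> real. continuous_on UNIV h \<and> bounded (range h) \<longrightarrow>
           (\<lambda>n. outer_expectation (\<Pi>\<^sub>M i\<in>(UNIV::nat set). Q)
                  (\<lambda>x. h (to_linf F (empirical_process Q n x)))) \<longlonglongrightarrow> integral\<^sup>L G h))"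

definition iid_sample :: "'w measure \<Rightarrow> 'z measure \<Rightarrow> 'i set \<Rightarrow> ('i \<Rightarrow> 'w \<Rightarrow> 'z) \<Rightarrow> bool" where
  "iid_sample M P I Z \<longleftrightarrow>
     prob_space.indep_vars M (\<lambda>_. P) Z I \<and> (\<forall>i\<in>I. distr M P (Z i) = P)"

text \<open>An observation is a triple \<open>(X, A, Y)\<close> of covariates, treatment and outcome with joint law \<open>P\<close>;
  the treatments form a finite type \<open>'q\<close>, and \<open>\<mu> x $ a\<close> is \<open>E(Y | X = x, A = a)\<close>.\<close>

definition outcome_regression ::
  "'x measure \<Rightarrow> ('x \<times> 'q::finite \<times> real) measure \<Rightarrow> ('x \<Rightarrow> real^'q) \<Rightarrow> bool" where
  "outcome_regression MX P \<mu> \<longleftrightarrow>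
     prob_space P \<and>
     sets P = sets (MX \<Otimes>\<^sub>M (count_space UNIV \<Otimes>\<^sub>M borel)) \<and>
     \<mu> \<in> MX \<rightarrow>\<^sub>M borel \<and>
     integrable P (\<lambda>(x, a, y). y) \<and>
     (AE (x, a, y) in P.
        real_cond_exp P (vimage_algebra (space P) (\<lambda>(x, a, y). (x, a)) (MX \<Otimes>\<^sub>M count_space UNIV))
          (\<lambda>(x, a, y). y) (x, a, y) = \<mu> x $ a)"

text \<open>The estimator is computed from \<open>N\<close> further observations that, jointly with the original sample
  \<open>Z\<close>, form an i.i.d. family.\<close>

definition separate_sample_estimator ::
  "'w measure \<Rightarrow> 'z measure \<Rightarrow> nat \<Rightarrow> (nat \<Rightarrow> 'w \<Rightarrow> 'z) \<Rightarrow> ('w \<Rightarrow> 'x \<Rightarrow> real^'q) \<Rightarrow> bool" where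
  "separate_sample_estimator M P N Z \<mu>h \<longleftrightarrow>
     (\<exists>(Z' :: nat \<Rightarrow> 'w \<Rightarrow> 'z) (est :: (nat \<Rightarrow> 'z) \<Rightarrow> 'x \<Rightarrow> real^'q).
        iid_sample M P ({..<N} <+> {..<N}) (case_sum Z Z') \<and>
        (AE w in M. \<mu>h w = est (restrict (\<lambda>i. Z' i w) {..<N})))"

text \<open>The sup-norm is extended-valued, since a function that is bounded almost surely may still be
  unbounded on \<open>\<X>\<close>.\<close>

definition sup_norm :: "'x set \<Rightarrow> ('x \<Rightarrow> real) \<Rightarrow> ennreal" where
  "sup_norm S f = (SUP x\<in>S. ennreal \<bar>f x\<bar>)"

definition sup_error :: "'x set \<Rightarrow> ('x \<Rightarrow> real^'q::finite) \<Rightarrow> ('x \<Rightarrow> real^'q) \<Rightarrow> ennreal" where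
  "sup_error S \<mu>h \<mu> = (\<Sum>a\<in>UNIV. sup_norm S (\<lambda>x. \<mu>h x $ a - \<mu> x $ a))"

definition bounded_density :: "real \<Rightarrow> (real^'q::finite) measure \<Rightarrow> bool" where
  "bounded_density D Q \<longleftrightarrow>
     (\<exists>f. f \<in> borel_measurable borel \<and> (\<forall>m. 0 \<le> f m \<and> f m \<le> D) \<and>
          Q = density lborel (\<lambda>m. ennreal (f m)))"

definition cluster :: "('m \<Rightarrow> nat) \<Rightarrow> 'm \<Rightarrow> 'm set" where
  "cluster l m' = {m. l m = l m'}"

text \<open>Radii are nonnegative extended reals, with \<open>inf \<emptyset> = \<infinity>\<close>.\<close>

definition gn_radius :: "('m::metric_space \<Rightarrow> nat) \<Rightarrow> 'm measure \<Rightarrow> 'm \<Rightarrow> ereal" where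
  "gn_radius l Q m' = Inf {ereal r |r. 0 \<le> r \<and> measure Q (ball m' r) = measure Q (cluster l m')}"

definition good_neighborhood_dist ::
  "('m::metric_space \<Rightarrow> nat) \<Rightarrow> real \<Rightarrow> real \<Rightarrow> 'm measure \<Rightarrow> bool" where
  "good_neighborhood_dist l \<alpha> \<nu> Q \<longleftrightarrow>
     0 \<le> \<nu> \<and> \<nu> \<le> 1 \<and>
     (\<exists>Q\<alpha> Qnoise.
        prob_space Q\<alpha> \<and> sets Q\<alpha> = sets borel \<and>
        prob_space Qnoise \<and> sets Qnoise = sets borel \<and>
        (\<forall>S\<in>sets borel. measure Q S = (1 - \<nu>) * measure Q\<alpha> S + \<nu> * measure Qnoise S) \<and>
        (\<forall>m'. measure Q\<alpha> ({m. ereal (dist m' m) < gn_radius l Q\<alpha> m'} - cluster l m') \<le> \<alpha>))"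

text \<open>A data set of \<open>N\<close> points is indexed by \<open>{..<N}\<close>, so that repeated points are counted with
  multiplicity. A point is one of its own nearest neighbors, and in the presence of ties the
  condition is imposed on every admissible choice \<open>S\<close> of the nearest neighbors.\<close>

definition nearest_neighbors ::
  "(nat \<Rightarrow> nat \<Rightarrow> real) \<Rightarrow> nat set \<Rightarrow> nat \<Rightarrow> nat \<Rightarrow> nat set \<Rightarrow> bool" where
  "nearest_neighbors d U u r S \<longleftrightarrow>
     S \<subseteq> U \<and> card S = r \<and> (\<forall>s\<in>S. \<forall>t\<in>U - S. d u s \<le> d u t)"

definition good_neighborhood ::
  "nat \<Rightarrow> (nat \<Rightarrow> nat \<Rightarrow> real) \<Rightarrow> (nat \<Rightarrow> nat) \<Rightarrow> real \<Rightarrow> real \<Rightarrow> bool" where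
  "good_neighborhood N d lab a v \<longleftrightarrow>
     (\<exists>U'\<subseteq>{..<N}. real (card U') \<ge> (1 - v) * N \<and>
        (\<forall>u\<in>U'. \<forall>S. nearest_neighbors d U' u (card (cluster lab u \<inter> U')) S \<longrightarrow>
           real (card (S - cluster lab u)) \<le> a * N))"

definition dissimilarity :: "nat \<Rightarrow> (nat \<Rightarrow> nat \<Rightarrow> real) \<Rightarrow> bool" where
  "dissimilarity N d \<longleftrightarrow>
     (\<forall>i<N. d i i = 0) \<and> (\<forall>i<N. \<forall>j<N. 0 \<le> d i j \<and> d i j = d j i)"

definition hierarchy :: "'i set \<Rightarrow> 'i set set \<Rightarrow> bool" where
  "hierarchy U H \<longleftrightarrow>
     U \<in> H \<and> (\<forall>A\<in>H. A \<noteq> {} \<and> A \<subseteq> U) \<and> (\<forall>A\<in>H. \<forall>B\<in>H. A \<inter> B = {} \<or> A \<subseteq> B \<or> B \<subseteq> A)"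

definition pruning :: "'i set \<Rightarrow> 'i set set \<Rightarrow> 'i set set \<Rightarrow> bool" where
  "pruning U H C \<longleftrightarrow> C \<subseteq> H \<and> partition_on U C"

text \<open>A matching \<open>\<sigma>\<close> assigns distinct target labels to clusters; clusters may stay unmatched, as their
  number can differ from the number of labels, and their points then count as misclassified.\<close>

definition clustering_error :: "'i set \<Rightarrow> ('i \<Rightarrow> nat) \<Rightarrow> 'i set set \<Rightarrow> real" where
  "clustering_error U lab C =
     real (INF \<sigma>\<in>{\<sigma> :: 'i set \<Rightarrow> nat option. inj_on \<sigma> (C \<inter> dom \<sigma>)}.
             card {i\<in>U. \<forall>A\<in>C. i \<in> A \<longrightarrow> \<sigma> A \<noteq> Some (lab i)}) / card U"

definition good_output :: "nat \<Rightarrow> (nat \<Rightarrow> nat) \<Rightarrow> real \<Rightarrow> nat set set \<Rightarrow> bool" where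
  "good_output N lab e H \<longleftrightarrow>
     hierarchy {..<N} H \<and> (\<exists>C. pruning {..<N} H C \<and> clustering_error {..<N} lab C \<le> e)"

definition min_cluster_size :: "nat \<Rightarrow> (nat \<Rightarrow> nat) \<Rightarrow> nat" where
  "min_cluster_size N lab = Min ((\<lambda>i. card (cluster lab i \<inter> {..<N})) ` {..<N})"

text \<open>The constants hidden in \<open>n = \<Theta>(1 / min(a, v) \<cdot> log (1 / (\<delta> min(a, v))))\<close> are \<open>\<theta>1\<close> and \<open>\<theta>2\<close>.\<close>

definition subset_size :: "real \<Rightarrow> real \<Rightarrow> real \<Rightarrow> real \<Rightarrow> real \<Rightarrow> nat \<Rightarrow> bool" where
  "subset_size \<theta>1 \<theta>2 a v \<delta> n \<longleftrightarrow>
     (let t = 1 / min a v * ln (1 / (\<delta> * min a v)) in \<theta>1 * t \<le> n \<and> n \<le> \<theta>2 * t)"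

definition random_subset :: "nat \<Rightarrow> nat \<Rightarrow> nat set pmf" where
  "random_subset N n = pmf_of_set {S. S \<subseteq> {..<N} \<and> card S = n}"

text \<open>The probability of an event \<open>E w S\<close> when \<open>w\<close> is drawn from \<open>M\<close> and then, given \<open>w\<close>, the subset
  \<open>S\<close> uniformly with size \<open>n w\<close>. The library's nonnegative integral of a nonmeasurable function is its
  lower integral, so a lower bound on this quantity needs no measurability of \<open>E\<close>.\<close>

definition sampling_prob :: "'w measure \<Rightarrow> nat \<Rightarrow> ('w \<Rightarrow> nat) \<Rightarrow> ('w \<Rightarrow> nat set \<Rightarrow> bool) \<Rightarrow> ennreal" where
  "sampling_prob M N n E = (\<integral>\<^sup>+ w. emeasure (measure_pmf (random_subset N (n w))) {S. E w S} \<partial>M)"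

text \<open>\<open>alg a v N d S\<close> is the hierarchy over \<open>{..<N}\<close> that the algorithm, with input parameters \<open>a\<close> and
  \<open>v\<close>, induces from the subset \<open>S\<close> and the dissimilarity \<open>d\<close>. It may be any procedure with the
  guarantee proved by Balcan, Liang and Gupta for theirs.\<close>

type_synonym clustering_algorithm =
  "real \<Rightarrow> real \<Rightarrow> nat \<Rightarrow> (nat \<Rightarrow> nat \<Rightarrow> real) \<Rightarrow> nat set \<Rightarrow> nat set set"

definition inductive_robust_hierarchical :: "real \<Rightarrow> real \<Rightarrow> clustering_algorithm \<Rightarrow> bool" where
  "inductive_robust_hierarchical \<theta>1 \<theta>2 alg \<longleftrightarrow>
     (\<forall>a v \<delta> N n d lab.
        0 < a \<and> 0 < v \<and> 0 < \<delta> \<and> \<delta> < 1 \<and> n < N \<and> subset_size \<theta>1 \<theta>2 a v \<delta> n \<and>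
        dissimilarity N d \<and> good_neighborhood N d lab a v \<and>
        real (min_cluster_size N lab) > 12 * (v + a) * N \<longrightarrow>
        measure_pmf.prob (random_subset N n) {S. good_output N lab (v + \<delta>) (alg a v N d S)} \<ge> 1 - \<delta>)"

definition deviation :: "real \<Rightarrow> nat \<Rightarrow> real \<Rightarrow> real" where
  "deviation c N \<delta>N = c * sqrt (1 / N * ln (1 / \<delta>N))"

definition epsilon :: "real \<Rightarrow> nat \<Rightarrow> real \<Rightarrow> real \<Rightarrow> real" where
  "epsilon c N \<delta>N \<gamma> =
     c * (\<gamma> + 1 / N * ln (1 / \<delta>N) + (if 0 < \<gamma> \<and> \<gamma> < 1 then sqrt (\<gamma> / N * ln (1 / \<gamma>)) else 0))"

end

theory Submission
  imports Defs
begin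

text \<open>Let \<open>Q = (1 - \<nu>) Q\<^sub>1 + \<nu> Q\<^sub>2\<close> be the law of the points, with \<open>Q\<^sub>1\<close> the well-clustered part. Attach to
  every sample point the label of its mixture component and let \<open>U\<close> consist of the points from
  \<open>Q\<^sub>1\<close>. With probability at least \<open>1 - \<delta>\<close>, simultaneously for all balls with bounded centre and
  radius, the number of points of \<open>U\<close> in the ball, in its complement, and in the part of the ball
  outside a given cluster exceeds its expectation by at most \<open>O(sqrt (N log (1 / \<delta>)))\<close>; because the
  density is bounded, thin shells carry little mass and chaining along finite nets of balls gives
  this without a factor \<open>log N\<close>. On this event, replacing the points by estimates at distance at
  most \<open>\<gamma>\<close> changes nearest-neighbour sets only within a shell of width \<open>4 \<gamma>\<close>, of mass \<open>O(\<gamma>)\<close>. The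
  event depends on the sample alone and serves all \<open>\<gamma>\<close> and all estimates at once, so
  neither the randomness of \<open>\<gamma>\<close> nor its dependence on the sample matters.\<close>

subsection \<open>Deviation bounds by chaining\<close>

text \<open>Every probabilistic estimate is one-sided: a count is only ever bounded above, by its
  mean plus an error. Chaining then needs outer approximations only, and a lower bound for the
  number of points in a ball follows from upper bounds for the points outside it and for the noise
  points.

  The constant may not depend on \<nu>, whereas the density of \<open>Q1\<close> is bounded only by
  \<open>D / (1 - \<nu>)\<close>. Wherever a shell contributes to the constant it is therefore
  measured under the whole law Q, which dominates (1 - \<nu>) Q1. Likewise, counts in U are compared
  with N (1 - \<nu>) Q1(S) under the joint law of label and point, instead of conditioning on the
  random size of U, so no quantity is divided by 1 - \<nu>.\<close>

abbreviation sample_measure :: "nat \<Rightarrow> 'a measure \<Rightarrow> (nat \<Rightarrow> 'a) measure" where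
  "sample_measure N R \<equiv> \<Pi>\<^sub>M i\<in>{..<N}. R"

section \<open>Exponential moments and tails of sums\<close>

lemma exp_le_quadratic:
  fixes x :: real
  assumes "\<bar>x\<bar> \<le> 1"
  shows "exp x \<le> 1 + x + x\<^sup>2"
proof (cases "0 \<le> x")
  case True
  then show ?thesis
    using exp_bound assms by simp
next
  case False
  have "1 \<le> (1 - x) * (1 + x + x\<^sup>2)"
  proof -
    have "(1 - x) * (1 + x + x\<^sup>2) = 1 - x ^ 3"
      by (simp add: algebra_simps power2_eq_square power3_eq_cube)
    moreover have "x ^ 3 \<le> 0"
      using False by (simp add: power_le_zero_eq)
    ultimately show ?thesis by simp
  qed
  also have "\<dots> \<le> exp (- x) * (1 + x + x\<^sup>2)"
  proof (rule mult_right_mono)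
    show "1 - x \<le> exp (- x)"
      using exp_ge_add_one_self[of "- x"] by simp
    show "0 \<le> 1 + x + x\<^sup>2"
      using assms by (smt (verit) zero_le_power2)
  qed
  finally have "exp x * 1 \<le> exp x * (exp (- x) * (1 + x + x\<^sup>2))"
    by (intro mult_left_mono) auto
  then show ?thesis
    by (simp add: mult.assoc[symmetric] exp_minus)
qed

text \<open>Expanding the exponential moment to second order keeps the mean exact in the linear
  term, so f is used uncentred and only its raw second moment enters. \<theta> is left free because
  the chain picks a different value at each level; its bound by 1, together with that on f, keeps
  the exponent where the quadratic estimate holds.\<close>

lemma bernstein_PiM:
  fixes R :: "'a measure" and f :: "'a \<Rightarrow> real"
  assumes R: "prob_space R" and f [measurable]: "f \<in> borel_measurable R"
    and bd: "\<And>x. x \<in> space R \<Longrightarrow> \<bar>f x\<bar> \<le> 1"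
    and lam: "0 < \<theta>" "\<theta> \<le> 1"
    and v: "(\<integral>x. (f x)\<^sup>2 \<partial>R) \<le> v"
  shows "measure (sample_measure N R)
           {z \<in> space (sample_measure N R). real N * integral\<^sup>L R f + t \<le> (\<Sum>i<N. f (z i))}
         \<le> exp (\<theta>\<^sup>2 * N * v - \<theta> * t)"
proof -
  interpret R: prob_space R by fact
  interpret PP: product_prob_space "\<lambda>_. R" "{..<N}" ..
  let ?P = "sample_measure N R"
  let ?u = "\<lambda>z. \<Prod>i<N. exp (\<theta> * f (z i))"
  have lf: "\<bar>\<theta> * f x\<bar> \<le> 1" if "x \<in> space R" for x
    using mult_mono[of "\<bar>\<theta>\<bar>" 1 "\<bar>f x\<bar>" 1] lam bd[OF that] by (simp add: abs_mult)
  have int_f: "integrable R f"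
    by (rule R.integrable_const_bound[where B=1]) (auto intro!: AE_I2 bd)
  have int_f2: "integrable R (\<lambda>x. (f x)\<^sup>2)"
    by (rule R.integrable_const_bound[where B=1]) (auto intro!: AE_I2 bd simp: abs_square_le_1)
  have int_exp: "integrable R (\<lambda>x. exp (\<theta> * f x))"
    by (rule R.integrable_const_bound[where B="exp 1"]) (auto intro!: AE_I2 dest: lf)
  have "(\<integral>x. exp (\<theta> * f x) \<partial>R) \<le> (\<integral>x. 1 + \<theta> * f x + \<theta>\<^sup>2 * (f x)\<^sup>2 \<partial>R)"
    using int_exp int_f int_f2 exp_le_quadratic[OF lf]
    by (intro integral_mono) (auto simp: power_mult_distrib)
  also have "\<dots> = 1 + \<theta> * integral\<^sup>L R f + \<theta>\<^sup>2 * (\<integral>x. (f x)\<^sup>2 \<partial>R)"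
    using int_f int_f2 by (simp add: R.prob_space)
  also have "\<dots> \<le> 1 + (\<theta> * integral\<^sup>L R f + \<theta>\<^sup>2 * v)"
    using v by (simp add: mult_left_mono)
  also have "\<dots> \<le> exp (\<theta> * integral\<^sup>L R f + \<theta>\<^sup>2 * v)"
    by (rule exp_ge_add_one_self)
  finally have mgf: "(\<integral>x. exp (\<theta> * f x) \<partial>R) \<le> exp (\<theta> * integral\<^sup>L R f + \<theta>\<^sup>2 * v)" .
  have int_u: "integrable ?P ?u" and eq_u: "integral\<^sup>L ?P ?u = (\<Prod>i<N. \<integral>x. exp (\<theta> * f x) \<partial>R)"
    using PP.product_integrable_prod[of "{..<N}" "\<lambda>_ x. exp (\<theta> * f x)"]
      PP.product_integral_prod[of "{..<N}" "\<lambda>_ x. exp (\<theta> * f x)"] int_exp by auto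
  have "integral\<^sup>L ?P ?u \<le> (\<Prod>i<N. exp (\<theta> * integral\<^sup>L R f + \<theta>\<^sup>2 * v))"
    unfolding eq_u by (intro prod_mono) (auto intro: mgf integral_nonneg_AE)
  also have "\<dots> = exp (N * (\<theta> * integral\<^sup>L R f + \<theta>\<^sup>2 * v))"
    by (simp add: exp_of_nat_mult)
  finally have u_le: "integral\<^sup>L ?P ?u \<le> exp (N * (\<theta> * integral\<^sup>L R f + \<theta>\<^sup>2 * v))" .
  let ?s = "exp (\<theta> * (N * integral\<^sup>L R f + t))"
  have "{z \<in> space ?P. real N * integral\<^sup>L R f + t \<le> (\<Sum>i<N. f (z i))} = {z \<in> space ?P. ?u z \<ge> ?s}"
    using lam by (auto simp: exp_sum[symmetric] sum_distrib_left[symmetric])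
  then have "measure ?P {z \<in> space ?P. real N * integral\<^sup>L R f + t \<le> (\<Sum>i<N. f (z i))}
      = measure ?P {z \<in> space ?P. ?u z \<ge> ?s}" by simp
  also have "\<dots> \<le> integral\<^sup>L ?P ?u / ?s"
    by (rule integral_Markov_inequality_measure[OF int_u, of "{}"]) (auto intro!: AE_I2 prod_nonneg)
  also have "\<dots> \<le> exp (N * (\<theta> * integral\<^sup>L R f + \<theta>\<^sup>2 * v)) / ?s"
    by (intro divide_right_mono u_le) auto
  also have "\<dots> = exp (\<theta>\<^sup>2 * N * v - \<theta> * t)"
    by (simp add: exp_diff[symmetric] algebra_simps)
  finally show ?thesis .
qed

lemma sum_indicator_eq_card:
  fixes z :: "nat \<Rightarrow> 'a"
  shows "(\<Sum>i<N. indicator A (z i)) = real (card {i\<in>{..<N}. z i \<in> A})"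
  by (simp add: indicator_def Int_def)

text \<open>The square of a difference of indicators is the indicator of the symmetric difference,
  so the counts of two nearly equal sets fluctuate almost together. Chain increments have this
  form.\<close>

lemma tail_indicator_diff:
  fixes R :: "'a measure"
  assumes R: "prob_space R" and A: "A \<in> sets R" and B: "B \<in> sets R"
    and lam: "0 < \<theta>" "\<theta> \<le> 1" and v: "measure R (A - B) + measure R (B - A) \<le> v"
  shows "measure (sample_measure N R)
           {z \<in> space (sample_measure N R). real N * (measure R A - measure R B) + t
              \<le> real (card {i\<in>{..<N}. z i \<in> A}) - real (card {i\<in>{..<N}. z i \<in> B})}
         \<le> exp (\<theta>\<^sup>2 * N * v - \<theta> * t)"
proof -
  interpret R: prob_space R by fact
  note [measurable] = A B
  let ?f = "\<lambda>x. indicator A x - indicator B x :: real"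
  have "(\<lambda>x. (?f x)\<^sup>2) = (\<lambda>x. indicator (A - B) x + indicator (B - A) x)"
    by (auto simp: indicator_def)
  then have f2: "(\<integral>x. (?f x)\<^sup>2 \<partial>R) \<le> v"
    using v A B sets.sets_into_space[OF A] sets.sets_into_space[OF B] 
    by (simp add: R.emeasure_eq_measure Int_absorb1 Int_absorb2 inf.absorb1 Diff_subset less_top[symmetric])
  have f1: "integral\<^sup>L R ?f = measure R A - measure R B"
    using A B sets.sets_into_space[OF A] sets.sets_into_space[OF B] by (simp add: R.emeasure_eq_measure Int_absorb1 Int_absorb2 less_top[symmetric])
  have "\<bar>?f x\<bar> \<le> 1" for x
    by (simp add: indicator_def)
  from bernstein_PiM[OF R _ this lam f2, of N t] show ?thesis
    by (simp only: f1 sum_subtractf sum_indicator_eq_card) simp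
qed

section \<open>Sums, constants and levels of the chain\<close>

lemma sum_Suc_div_two_power: "(\<Sum>j\<le>J. (real j + 1) / 2 ^ j) = 4 - (real J + 3) / 2 ^ J"
  by (induction J) (auto simp: field_simps)

lemma sum_half_powers: "(\<Sum>j\<le>J. (1 / 2 :: real) ^ (j + 1)) = 1 - (1 / 2) ^ (J + 1)"
  by (induction J) (auto simp: field_simps)

text \<open>\<open>5 * C + 1\<close> bounds the variance of an increment in units of
  \<open>(1 / 4) ^ j\<close>. The term \<open>1 + (2 * ln K + ln 2) / ln 2\<close> pays for the
  failure probability, the number of increments and the split of \<delta> over the levels. The
  leading 4 bounds the sum of the weights \<open>(j + 1) / 2 ^ j\<close>, and \<open>4 * C\<close>
  is the approximation error at the last level.\<close>

definition chaining_const :: "real \<Rightarrow> real \<Rightarrow> real" where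
  "chaining_const C K = 4 * (5 * C + 1 + (1 + (2 * ln K + ln 2) / ln 2)) + 4 * C + 1"

lemma obtain_level:
  fixes x :: real
  assumes "1 \<le> x"
  obtains J :: nat where "4 ^ J \<le> x" "x < 4 ^ (J + 1)"
proof -
  have "nat \<lfloor>x\<rfloor> \<ge> 1"
    using assms by (simp add: le_nat_iff)
  then obtain J where J: "4 ^ J \<le> nat \<lfloor>x\<rfloor>" "nat \<lfloor>x\<rfloor> < 4 ^ (J + 1)"
    using ex_power_ivl1[of 4 "nat \<lfloor>x\<rfloor>"] by auto
  have "real (4 ^ J) \<le> real (nat \<lfloor>x\<rfloor>)" "real (nat \<lfloor>x\<rfloor>) + 1 \<le> real (4 ^ (J + 1))"
    using J by (simp only: of_nat_le_iff, linarith)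
  moreover have "real (nat \<lfloor>x\<rfloor>) \<le> x" "x < real (nat \<lfloor>x\<rfloor>) + 1"
    using assms by linarith+
  ultimately have "real (4 ^ J) \<le> x" "x < real (4 ^ (J + 1))"
    by linarith+
  then show ?thesis using that[of J] by simp
qed

text \<open>The increments at level \<open>j\<close> have variance \<open>O(4\<^sup>-\<^sup>j)\<close> and there are at most \<open>K\<^sup>2\<^sup>j\<^sup>+\<^sup>2\<close> of them, so
  Bernstein's inequality with parameter \<open>2\<^sup>j sqrt (log (1 / \<delta>) / N)\<close> bounds them by a summable multiple of
  \<open>sqrt (N log (1 / \<delta>))\<close>. The chain stops at the level where \<open>4\<^sup>-\<^sup>j\<close> reaches \<open>sqrt (log (1 / \<delta>) / N)\<close>,
  which also keeps the Bernstein parameter below \<open>1\<close>.\<close>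

lemma chaining_upper_deviation:
  fixes R :: "'a measure" and W :: "'p \<Rightarrow> 'a set" and V :: "nat \<Rightarrow> 'p \<Rightarrow> 'a set" and N :: nat
  assumes R: "prob_space R" and N: "0 < N" and \<delta>: "0 < \<delta>" "\<delta> \<le> 1 / 2"
    and C: "0 \<le> C" and K: "1 \<le> K"
    and W: "\<And>p. p \<in> T \<Longrightarrow> W p \<in> sets R"
    and V: "\<And>j p. p \<in> T \<Longrightarrow> V j p \<in> sets R"
    and WV: "\<And>j p. p \<in> T \<Longrightarrow> W p \<subseteq> V j p"
    and outer: "\<And>j p. p \<in> T \<Longrightarrow> measure R (V j p) \<le> measure R (W p) + C * (1 / 4) ^ j"
    and fin: "\<And>j. finite (V j ` T)" and card: "\<And>j. real (card (V j ` T)) \<le> K ^ (j + 1)"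
  shows "\<exists>G\<in>sets (sample_measure N R). 1 - \<delta> \<le> measure (sample_measure N R) G \<and>
           (\<forall>z\<in>G. \<forall>p\<in>T. real (card {i\<in>{..<N}. z i \<in> W p})
              \<le> N * measure R (W p) + chaining_const C K * sqrt (N * ln (1 / \<delta>)))"
proof -
  interpret R: prob_space R by fact
  let ?P = "sample_measure N R"
  interpret P: prob_space ?P
    by (intro prob_space_PiM R)
  define L where "L = ln (1 / \<delta>)"
  define \<kappa> where "\<kappa> = 1 + (2 * ln K + ln 2) / ln 2"
  have lnK: "0 \<le> ln K"
    using K by simp
  have \<kappa>: "1 \<le> \<kappa>"
    unfolding \<kappa>_def using lnK by simp
  have cc: "chaining_const C K = 4 * (5 * C + 1 + \<kappa>) + 4 * C + 1"
    by (simp add: chaining_const_def \<kappa>_def)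
  \<comment> \<open>This is where \<open>\<delta> \<le> 1 / 2\<close> enters: constants such as
    \<open>ln K\<close> can be absorbed into a multiple of L.\<close>
  have "ln (2::real) \<le> L"
    unfolding L_def using \<delta> by (subst ln_le_cancel_iff) (auto simp: field_simps)
  then have L: "0 < L" "ln 2 \<le> L"
    using ln_gt_zero[of "2::real"] by linarith+
  have cpos: "1 \<le> chaining_const C K"
    unfolding cc using C \<kappa> by simp
  show ?thesis
  proof (cases "L \<le> N")
    \<comment> \<open>Here L exceeds N, so the allowed deviation is at least N, which no count
      exceeds; every sample is good.\<close>
    case False
    have "real (card {i\<in>{..<N}. z i \<in> W p}) \<le> N * measure R (W p) + chaining_const C K * sqrt (N * L)"
      for z p
    proof -
      have "real (card {i\<in>{..<N}. z i \<in> W p}) \<le> N"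
        using card_mono[OF finite_lessThan, of "{i\<in>{..<N}. z i \<in> W p}" N] by (simp add: subset_iff)
      also have "real N = sqrt (N * N)" by simp
      also have "\<dots> \<le> sqrt (N * L)"
        using False N by (intro real_sqrt_le_mono) simp
      also have "\<dots> \<le> chaining_const C K * sqrt (N * L)"
        using mult_right_mono[OF cpos, of "sqrt (N * L)"] L by simp
      also have "\<dots> \<le> N * measure R (W p) + \<dots>" by simp
      finally show ?thesis .
    qed
    then show ?thesis
      using \<delta> P.prob_space by (intro bexI[of _ "space ?P"]) (auto simp: L_def)
  next
    case True
    define s where "s = sqrt (N * L)"
    have s: "0 < s" "s\<^sup>2 = N * L"
      using N L by (auto simp: s_def)
    have x1: "1 \<le> N / s"
    proof -
      have "s \<le> sqrt (N * N)"
        unfolding s_def using True N by (intro real_sqrt_le_mono) simp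
      then show ?thesis using s by (simp add: field_simps)
    qed
    obtain J where J: "4 ^ J \<le> N / s" "N / s < 4 ^ (J + 1)"
      using obtain_level[OF x1] by blast
    \<comment> \<open>The predecessor of level 0 is the empty set: the first increment is the whole
      count of \<open>V 0 p\<close>, and the chain telescopes without an initial term.\<close>
    define V' where "V' = (\<lambda>j p. case j of 0 \<Rightarrow> {} | Suc i \<Rightarrow> V i p)"
    have V'_sets: "V' j p \<in> sets R" if "p \<in> T" for j p
      using V[OF that] by (auto simp: V'_def split: nat.split)
    \<comment> \<open>For \<theta> = \<open>s / N * 2 ^ j\<close> the factor
      \<open>1 / 2 ^ j\<close> cancels in \<open>\<theta> * t j\<close>, which becomes a multiple of
      \<open>L * (j + 1)\<close>; this linear growth in the exponent beats the exponential number of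
      increments.\<close>
    define t where "t = (\<lambda>j::nat. s * (5 * C + 1 + \<kappa>) * ((real j + 1) / 2 ^ j))"
    define A where "A = (\<lambda>j. (\<lambda>p. (V j p, V' j p)) ` T)"
    define bad where "bad = (\<lambda>j (U, U'). {z \<in> space ?P. real N * (measure R U - measure R U') + t j
              \<le> real (card {i\<in>{..<N}. z i \<in> U}) - real (card {i\<in>{..<N}. z i \<in> U'})})"
    have A_sub: "A j \<subseteq> V j ` T \<times> V' j ` T" for j
      unfolding A_def by auto
    have finV': "finite (V' j ` T)" for j
      using fin by (cases j) (auto simp: V'_def image_constant_conv)
    have cardV': "real (card (V' j ` T)) \<le> K ^ (j + 1)" for j
    proof (cases j)
      case 0
      then show ?thesis using K by (auto simp: V'_def image_constant_conv)
    next
      case (Suc i)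
      have "K ^ (i + 1) \<le> K ^ (j + 1)"
        using K Suc by (intro power_increasing) auto
      then show ?thesis using card[of i] Suc by (simp add: V'_def)
    qed
    have finA: "finite (A j)" for j
      using finite_subset[OF A_sub] fin finV' by auto
    have cardA: "real (card (A j)) \<le> K ^ (2 * j + 2)" for j
    proof -
      have "card (A j) \<le> card (V j ` T \<times> V' j ` T)"
        using A_sub fin finV' by (intro card_mono) auto
      then have "real (card (A j)) \<le> real (card (V j ` T)) * real (card (V' j ` T))"
        by (metis card_cartesian_product of_nat_le_iff of_nat_mult)
      also have "\<dots> \<le> K ^ (j + 1) * K ^ (j + 1)"
        using card cardV' K by (intro mult_mono) auto
      also have "\<dots> = K ^ (2 * j + 2)"
        by (simp only: power_add[symmetric]) (simp add: mult_2)
      finally show ?thesis .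
    qed
    have card_meas: "(\<lambda>z. real (card {i\<in>{..<N}. z i \<in> U})) \<in> borel_measurable ?P" if [measurable]: "U \<in> sets R" for U
      unfolding sum_indicator_eq_card[symmetric] by measurable
    have bad_sets: "bad j UU \<in> sets ?P" if UU_in: "UU \<in> A j" for j UU
    proof -
      obtain U U' where UU: "UU = (U, U')" "U \<in> sets R" "U' \<in> sets R"
        using UU_in V V'_sets unfolding A_def by auto
      note [measurable] = card_meas[OF UU(2)] card_meas[OF UU(3)]
      show ?thesis unfolding bad_def UU(1) prod.case by measurable
    qed
    have bad_prob: "measure ?P (bad j UU) \<le> \<delta> * (1 / 2) ^ (j + 1) / K ^ (2 * j + 2)"
      if UU: "UU \<in> A j" and j: "j \<le> J" for j UU
    proof -
      obtain p where p: "p \<in> T" "UU = (V j p, V' j p)"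
        using UU unfolding A_def by auto
      \<comment> \<open>Successive approximations need not be nested, but both contain
        \<open>W p\<close>, so each one-sided difference lies in one approximation minus
        \<open>W p\<close>. Level j contributes \<open>C * (1 / 4) ^ j\<close> and level j - 1 four
        times as much; at level 0 the trivial bound 1 is used, hence C + 1.\<close>
      have m1: "measure R (V j p - V' j p) \<le> (C + 1) * (1 / 4) ^ j"
      proof (cases j)
        case 0
        then show ?thesis using C R.prob_le_1 by (auto intro: order_trans)
      next
        case (Suc i)
        have "measure R (V j p - V' j p) \<le> measure R (V j p - W p)"
          using WV[OF p(1)] V W p V'_sets Suc by (intro R.finite_measure_mono) (auto simp: V'_def)
        also have "\<dots> = measure R (V j p) - measure R (W p)"
          using V W WV p by (intro R.finite_measure_Diff) auto
        also have "\<dots> \<le> C * (1 / 4) ^ j"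
          using outer[OF p(1), of j] by simp
        also have "\<dots> \<le> (C + 1) * (1 / 4) ^ j"
          by (intro mult_right_mono) auto
        finally show ?thesis .
      qed
      have m2: "measure R (V' j p - V j p) \<le> 4 * C * (1 / 4) ^ j"
      proof (cases j)
        case 0
        then show ?thesis using C by (simp add: V'_def)
      next
        case (Suc i)
        have "measure R (V' j p - V j p) \<le> measure R (V i p - W p)"
          using WV[OF p(1)] V W p V'_sets Suc by (intro R.finite_measure_mono) (auto simp: V'_def)
        also have "\<dots> = measure R (V i p) - measure R (W p)"
          using V W WV p by (intro R.finite_measure_Diff) auto
        also have "\<dots> \<le> C * (1 / 4) ^ i"
          using outer[OF p(1), of i] by simp
        also have "\<dots> = 4 * C * (1 / 4) ^ j"
          using Suc by simp
        finally show ?thesis .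
      qed
      define \<theta> where "\<theta> = s / N * 2 ^ j"
      have lam: "0 < \<theta>" "\<theta> \<le> 1"
      proof -
        show "0 < \<theta>" using s N by (simp add: \<theta>_def)
        have "(2::real) ^ j \<le> 4 ^ j" by (intro power_mono) auto
        also have "\<dots> \<le> 4 ^ J" using j by (intro power_increasing) auto
        also have "\<dots> \<le> N / s" by fact
        finally show "\<theta> \<le> 1" using s N by (simp add: \<theta>_def field_simps)
      qed
      have sL: "s / N * s = L"
        using s N by (simp add: power2_eq_square field_simps)
      have "\<theta>\<^sup>2 * N = (s / N * s) * (2 ^ j * 2 ^ j)"
        using N by (simp add: \<theta>_def power2_eq_square)
      also have "\<dots> = L * 4 ^ j"
        unfolding sL by (simp flip: power_mult_distrib)
      finally have "\<theta>\<^sup>2 * N = L * 4 ^ j" .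
      then have e1: "\<theta>\<^sup>2 * N * ((5 * C + 1) * (1 / 4) ^ j) = L * (5 * C + 1)"
        by (simp add: power_divide)
      have "\<theta> * t j = (s / N * s) * (5 * C + 1 + \<kappa>) * (real j + 1)"
        by (simp add: \<theta>_def t_def)
      then have e2: "\<theta> * t j = L * (5 * C + 1 + \<kappa>) * (real j + 1)"
        unfolding sL .
      have "\<theta>\<^sup>2 * N * ((5 * C + 1) * (1 / 4) ^ j) - \<theta> * t j \<le> - (L * \<kappa> * (real j + 1))"
      proof -
        have "L * (5 * C + 1) * 1 \<le> L * (5 * C + 1) * (real j + 1)"
          using L C by (intro mult_left_mono) auto
        then show ?thesis unfolding e1 e2 by (simp add: algebra_simps)
      qed
      \<comment> \<open>Of \<open>L * \<kappa> * (j + 1)\<close>, one L yields the factor \<delta>,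
        while \<kappa> - 1, normalised through \<open>ln 2 \<le> L\<close>, yields
        \<open>2 * ln K + ln 2\<close> for each unit of j + 1.\<close>
      also have "\<dots> \<le> - (L + (real j + 1) * (2 * ln K + ln 2))"
      proof -
        have "(2 * ln K + ln 2) = ln 2 * (\<kappa> - 1)"
          by (simp add: \<kappa>_def)
        also have "\<dots> \<le> L * (\<kappa> - 1)"
          using L \<kappa> by (intro mult_right_mono) auto
        finally have "(real j + 1) * (2 * ln K + ln 2) \<le> (real j + 1) * (L * (\<kappa> - 1))"
          by (intro mult_left_mono) auto
        moreover have "L \<le> L * (real j + 1)"
          using L by (simp add: mult_le_cancel_left1)
        ultimately show ?thesis by (simp add: algebra_simps)
      qed
      finally have "exp (\<theta>\<^sup>2 * N * ((5 * C + 1) * (1 / 4) ^ j) - \<theta> * t j)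
          \<le> exp (- (L + (real j + 1) * (2 * ln K + ln 2)))"
        by simp
      also have "\<dots> = \<delta> * (1 / 2) ^ (j + 1) / K ^ (2 * j + 2)"
      proof -
        have "exp (- L) = \<delta>"
          using \<delta> by (simp add: L_def ln_div)
        moreover have "exp ((real j + 1) * ln 2) = 2 ^ (j + 1)"
          by (metis exp_ln exp_of_nat_mult of_nat_1 of_nat_add zero_less_numeral)
        moreover have "exp ((2 * real j + 2) * ln K) = K ^ (2 * j + 2)"
          using K exp_of_nat_mult[of "2 * j + 2" "ln K"] by (simp add: algebra_simps)
        ultimately have "exp (- L - (real j + 1) * ln 2 - (2 * real j + 2) * ln K)
            = \<delta> / 2 ^ (j + 1) / K ^ (2 * j + 2)"
          by (simp only: exp_diff)
        moreover have "- (L + (real j + 1) * (2 * ln K + ln 2)) =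
            - L - (real j + 1) * ln 2 - (2 * real j + 2) * ln K"
          by (simp add: algebra_simps)
        ultimately show ?thesis by (simp only: power_divide power_one) simp
      qed
      finally have *: "exp (\<theta>\<^sup>2 * N * ((5 * C + 1) * (1 / 4) ^ j) - \<theta> * t j)
          \<le> \<delta> * (1 / 2) ^ (j + 1) / K ^ (2 * j + 2)" .
      have "measure ?P (bad j UU) \<le> exp (\<theta>\<^sup>2 * N * ((5 * C + 1) * (1 / 4) ^ j) - \<theta> * t j)"
        unfolding bad_def p(2) prod.case using m1 m2
        by (intro tail_indicator_diff R V V'_sets p lam) (simp add: algebra_simps)
      with * show ?thesis by linarith
    qed
    define Bad where "Bad = (\<Union>j\<in>{..J}. \<Union>UU\<in>A j. bad j UU)"
    have Bad_sets: "Bad \<in> sets ?P"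
      unfolding Bad_def using finA bad_sets by (intro sets.finite_UN) auto
    have "measure ?P Bad \<le> (\<Sum>j\<le>J. \<delta> * (1 / 2) ^ (j + 1))"
      unfolding Bad_def
    proof (rule order_trans[OF measure_UNION_le sum_mono])
      fix j assume j: "j \<in> {..J}"
      show "(\<Union>UU\<in>A j. bad j UU) \<in> sets ?P"
        using finA bad_sets by (intro sets.finite_UN) auto
      have "measure ?P (\<Union>UU\<in>A j. bad j UU) \<le> (\<Sum>UU\<in>A j. measure ?P (bad j UU))"
        using finA bad_sets by (intro measure_UNION_le) auto
      also have "\<dots> \<le> (\<Sum>UU\<in>A j. \<delta> * (1 / 2) ^ (j + 1) / K ^ (2 * j + 2))"
        using bad_prob j by (intro sum_mono) auto
      also have "\<dots> = real (card (A j)) * (\<delta> * (1 / 2) ^ (j + 1) / K ^ (2 * j + 2))"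
        by simp
      also have "\<dots> \<le> K ^ (2 * j + 2) * (\<delta> * (1 / 2) ^ (j + 1) / K ^ (2 * j + 2))"
        using cardA \<delta> K by (intro mult_right_mono) auto
      also have "\<dots> = \<delta> * (1 / 2) ^ (j + 1)"
        using K by simp
      finally show "measure ?P (\<Union>UU\<in>A j. bad j UU) \<le> \<delta> * (1 / 2) ^ (j + 1)" .
    qed auto
    also have "\<dots> \<le> \<delta>"
      using \<delta> by (subst sum_distrib_left[symmetric], subst sum_half_powers) (simp add: mult_le_cancel_left1)
    finally have Bad_le: "measure ?P Bad \<le> \<delta>" .
    show ?thesis
    proof (intro bexI[of _ "space ?P - Bad"] conjI ballI)
      show "space ?P - Bad \<in> sets ?P" using Bad_sets by auto
      show "1 - \<delta> \<le> measure ?P (space ?P - Bad)"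
        using P.prob_compl[OF Bad_sets] Bad_le by simp
      fix z p assume z: "z \<in> space ?P - Bad" and p: "p \<in> T"
      define cnt where "cnt = (\<lambda>U. real (card {i\<in>{..<N}. z i \<in> U}))"
      have step: "cnt (V j p) - cnt (V' j p) \<le> N * (measure R (V j p) - measure R (V' j p)) + t j"
        if "j \<le> J" for j
      proof -
        have "z \<notin> bad j (V j p, V' j p)"
          using z p that by (auto simp: Bad_def A_def)
        then show ?thesis using z by (auto simp: bad_def cnt_def)
      qed
      have chain: "cnt (V j p) \<le> N * measure R (V j p) + (\<Sum>i\<le>j. t i)" if "j \<le> J" for j
        using that
      proof (induction j)
        case 0
        then show ?case using step[of 0] by (simp add: V'_def cnt_def)
      next
        case (Suc j)
        then show ?case using step[of "Suc j"] by (simp add: V'_def algebra_simps)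
      qed
      have "cnt (W p) \<le> cnt (V J p)"
        unfolding cnt_def of_nat_le_iff using WV[OF p] by (intro card_mono) auto
      also have "\<dots> \<le> N * measure R (V J p) + (\<Sum>i\<le>J. t i)"
        using chain by simp
      also have "\<dots> \<le> N * (measure R (W p) + C * (1 / 4) ^ J) + s * (5 * C + 1 + \<kappa>) * 4"
      proof (intro add_mono mult_left_mono outer p)
        have "(\<Sum>i\<le>J. t i) = s * (5 * C + 1 + \<kappa>) * (4 - (real J + 3) / 2 ^ J)"
          unfolding t_def sum_distrib_left[symmetric] sum_Suc_div_two_power ..
        also have "\<dots> \<le> s * (5 * C + 1 + \<kappa>) * 4"
          using s C \<kappa> by (intro mult_left_mono) auto
        finally show "(\<Sum>i\<le>J. t i) \<le> s * (5 * C + 1 + \<kappa>) * 4" .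
      qed auto
      also have "\<dots> \<le> N * measure R (W p) + chaining_const C K * s"
      proof -
        \<comment> \<open>The upper half of the choice of J: the chain is long enough for the last
          approximation error to be of the order of the deviation.\<close>
        have "N * (1 / 4) ^ J \<le> 4 * s"
          using J(2) s by (simp add: field_simps power_one_over)
        then have "C * (N * (1 / 4) ^ J) \<le> C * (4 * s)"
          using C by (intro mult_left_mono) auto
        then show ?thesis unfolding cc using s by (simp add: algebra_simps)
      qed
      finally show "real (card {i\<in>{..<N}. z i \<in> W p})
              \<le> N * measure R (W p) + chaining_const C K * sqrt (N * ln (1 / \<delta>))"
        by (simp add: cnt_def s_def L_def)
    qed
  qed
qed

subsection \<open>Counting sample points in balls\<close>

text \<open>Placing a scaled copy of one fixed 1/4-net of the unit ball around each point of a net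
  refines the mesh by 4 and multiplies the size by a constant, which gives geometric growth from
  total boundedness alone.\<close>

lemma cball_nets:
  fixes b :: real
  shows "\<exists>K\<ge>1. \<forall>j::nat. \<exists>F. finite F \<and> real (card F) \<le> K ^ (j + 1) \<and>
           (\<forall>x\<in>cball (0::'b::euclidean_space) b. \<exists>y\<in>F. dist x y \<le> (1 / 4) ^ j)"
proof -
  have tb: "\<exists>F. finite F \<and> cball (0::'b) r \<subseteq> (\<Union>x\<in>F. ball x e)" if "0 < e" for r e
    using compact_cball[of "0::'b" r] that unfolding compact_eq_totally_bounded by blast
  obtain F0 where F0: "finite F0" "cball (0::'b) b \<subseteq> (\<Union>x\<in>F0. ball x 1)"
    using tb[of 1 b] by auto
  obtain F1 where F1: "finite F1" "cball (0::'b) 1 \<subseteq> (\<Union>x\<in>F1. ball x (1 / 4))"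
    using tb[of "1 / 4" 1] by auto
  define K where "K = max 1 (max (real (card F0)) (real (card F1)))"
  have "\<exists>F. finite F \<and> real (card F) \<le> K ^ (j + 1) \<and>
           (\<forall>x\<in>cball (0::'b) b. \<exists>y\<in>F. dist x y \<le> (1 / 4) ^ j)" for j :: nat
  proof (induction j)
    case 0
    show ?case
    proof (intro exI[of _ F0] conjI ballI)
      fix x :: 'b assume "x \<in> cball 0 b"
      then obtain y where "y \<in> F0" "dist y x < 1" using F0 by auto
      then show "\<exists>y\<in>F0. dist x y \<le> (1 / 4) ^ 0"
        by (intro bexI[of _ y]) (auto simp: dist_commute)
    qed (use F0 in \<open>auto simp: K_def\<close>)
  next
    case (Suc j)
    then obtain F where F: "finite F" "real (card F) \<le> K ^ (j + 1)"
      "\<And>x. x \<in> cball (0::'b) b \<Longrightarrow> \<exists>y\<in>F. dist x y \<le> (1 / 4) ^ j" by blast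
    define h :: real where "h = (1 / 4) ^ j"
    have h: "0 < h" by (simp add: h_def)
    let ?F' = "(\<lambda>(y, z). y + h *\<^sub>R z) ` (F \<times> F1)"
    show ?case
    proof (intro exI[of _ ?F'] conjI ballI)
      show "finite ?F'" using F F1 by auto
      have "card ?F' \<le> card F * card F1"
        using card_image_le[of "F \<times> F1"] F F1 by (simp add: card_cartesian_product)
      then have "real (card ?F') \<le> real (card F) * real (card F1)"
        by (metis of_nat_le_iff of_nat_mult)
      also have "\<dots> \<le> K ^ (j + 1) * K"
        using F by (intro mult_mono) (auto simp: K_def)
      finally show "real (card ?F') \<le> K ^ (Suc j + 1)"
        by (simp add: mult_ac)
      fix x :: 'b assume "x \<in> cball 0 b"
      then obtain y where y: "y \<in> F" "dist x y \<le> h" using F unfolding h_def by blast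
      have "(1 / h) *\<^sub>R (x - y) \<in> cball 0 1"
        unfolding mem_cball dist_0_norm norm_scaleR using y h by (simp add: dist_norm)
      then have "(1 / h) *\<^sub>R (x - y) \<in> (\<Union>x\<in>F1. ball x (1 / 4))" using F1 by blast
      then obtain z where z: "z \<in> F1" "dist z ((1 / h) *\<^sub>R (x - y)) < 1 / 4" by auto
      have "dist x (y + h *\<^sub>R z) = norm (h *\<^sub>R (z - (1 / h) *\<^sub>R (x - y)))"
        using h by (simp add: dist_norm algebra_simps norm_minus_commute)
      also have "\<dots> = h * dist z ((1 / h) *\<^sub>R (x - y))"
        using h by (simp add: dist_norm)
      also have "\<dots> \<le> h * (1 / 4)"
        using z h by (intro mult_left_mono) auto
      finally show "\<exists>y\<in>?F'. dist x y \<le> (1 / 4) ^ Suc j"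
        using y z by (intro bexI[of _ "y + h *\<^sub>R z"]) (auto simp: h_def mult.commute)
    qed
  qed
  then show ?thesis
    by (intro exI[of _ K]) (auto simp: K_def)
qed

section \<open>Balls and shells under a bounded density\<close>

lemma power_diff_le:
  fixes a b c :: real
  assumes "0 \<le> a" "a \<le> b" "b \<le> c"
  shows "b ^ n - a ^ n \<le> real n * c ^ (n - 1) * (b - a)"
proof (cases n)
  case (Suc m)
  have "b ^ n - a ^ n = (b - a) * (\<Sum>i<n. a ^ (n - Suc i) * b ^ i)"
    by (rule power_diff_sumr2)
  also have "\<dots> \<le> (b - a) * (\<Sum>i<n. c ^ m)"
  proof (intro mult_left_mono sum_mono)
    fix i assume "i \<in> {..<n}"
    then have "m = (n - Suc i) + i" using Suc by auto
    moreover have "a ^ (n - Suc i) * b ^ i \<le> c ^ (n - Suc i) * c ^ i"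
      using assms by (intro mult_mono power_mono) auto
    ultimately show "a ^ (n - Suc i) * b ^ i \<le> c ^ m"
      by (metis power_add)
  qed (use assms in auto)
  finally show ?thesis using Suc by (simp add: mult_ac)
qed auto

text \<open>Restricted to bounded sets because the real-valued \<open>measure\<close> is 0 on sets
  of infinite volume, where the inequality would fail.\<close>

definition bounded_by_volume :: "real \<Rightarrow> 'b::euclidean_space measure \<Rightarrow> bool" where
  "bounded_by_volume D Q \<longleftrightarrow>
     (\<forall>S\<in>sets borel. bounded S \<longrightarrow> measure Q S \<le> D * measure lborel S)"

text \<open>D times the derivative at \<rho> of the volume of a q-dimensional ball, that is, the
  largest shell mass per unit width for radii up to \<rho>.\<close>

definition shell_const :: "real \<Rightarrow> real \<Rightarrow> nat \<Rightarrow> real" where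
  "shell_const D \<rho> q = D * (unit_ball_vol q * (real q * \<rho> ^ (q - 1)))"

text \<open>The balls need not be concentric: by nesting, the volume of the shell is a difference of
  ball volumes, which depends on the radii only. Moving a centre thus costs no more than the
  enlargement of the radius that absorbs the move.\<close>

lemma measure_shell_le:
  fixes Q :: "'b::euclidean_space measure"
  assumes D: "bounded_by_volume D Q" "0 \<le> D" and sub: "ball c r \<subseteq> ball c' r'"
    and r: "0 \<le> r" "r \<le> r'" "r' \<le> \<rho>"
  shows "measure Q (ball c' r' - ball c r) \<le> shell_const D \<rho> DIM('b) * (r' - r)"
proof -
  have "measure Q (ball c' r' - ball c r) \<le> D * measure lborel (ball c' r' - ball c r)"
    using D unfolding bounded_by_volume_def by (auto simp: bounded_diff)
  also have "measure lborel (ball c' r' - ball c r) = measure lborel (ball c' r') - measure lborel (ball c r)"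
    using emeasure_lborel_ball_finite[of c' r'] by (intro measure_Diff sub) auto
  also have "\<dots> = unit_ball_vol DIM('b) * (r' ^ DIM('b) - r ^ DIM('b))"
    using r by (simp add: content_ball algebra_simps)
  also have "D * \<dots> \<le> D * (unit_ball_vol DIM('b) * (real DIM('b) * \<rho> ^ (DIM('b) - 1) * (r' - r)))"
    using r D by (intro mult_left_mono power_diff_le) auto
  finally show ?thesis by (simp add: shell_const_def mult_ac)
qed

text \<open>The boolean is there because the outside part turns upper deviation bounds into lower
  ones. The map m extracts the location of a sample point, which may also carry a label.\<close>

definition ball_trace :: "('a \<Rightarrow> 'b::metric_space) \<Rightarrow> 'a set \<Rightarrow> bool \<Rightarrow> 'b \<Rightarrow> real \<Rightarrow> 'a set" where
  "ball_trace m E s c r = (if s then E \<inter> m -` ball c r else E - m -` ball c r)"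

lemma shell_const_nonneg: "0 \<le> D \<Longrightarrow> 0 \<le> \<rho> \<Longrightarrow> 0 \<le> shell_const D \<rho> q"
  by (simp add: shell_const_def)

text \<open>A ball is a point (centre, radius) of a product space, so nets of one bounded set there
  discretise all balls at once. The constant is produced before the law, since it depends only on D,
  b, \<rho>, n and the dimension.\<close>

lemma uniform_ball_deviation:
  fixes b \<rho> D :: real and n :: nat
  assumes D: "0 \<le> D" and \<rho>: "0 \<le> \<rho>"
  obtains c where "0 < c" and "\<And>(R :: 'a measure) (m :: 'a \<Rightarrow> 'b::euclidean_space) (\<E> :: 'a set set) \<delta> (N :: nat).
    prob_space R \<Longrightarrow> m \<in> borel_measurable R \<Longrightarrow> bounded_by_volume D (distr R borel m) \<Longrightarrow>
    \<E> \<subseteq> sets R \<Longrightarrow> finite \<E> \<Longrightarrow> card \<E> \<le> n \<Longrightarrow> 0 < N \<Longrightarrow> 0 < \<delta> \<Longrightarrow> \<delta> \<le> 1 / 2 \<Longrightarrow>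
    \<exists>G\<in>sets (sample_measure N R). 1 - \<delta> \<le> measure (sample_measure N R) G \<and>
       (\<forall>z\<in>G. \<forall>E\<in>\<E>. \<forall>s. \<forall>c'\<in>cball 0 b. \<forall>r\<in>{0..\<rho>}.
          real (card {i\<in>{..<N}. z i \<in> ball_trace m E s c' r})
            \<le> N * measure R (ball_trace m E s c' r) + c * sqrt (N * ln (1 / \<delta>)))"
proof -
  obtain K0 where K0: "1 \<le> K0" and "\<And>j::nat. \<exists>F. finite F \<and> real (card F) \<le> K0 ^ (j + 1) \<and>
           (\<forall>x\<in>cball (0::'b \<times> real) (\<bar>b\<bar> + \<rho>). \<exists>y\<in>F. dist x y \<le> (1 / 4) ^ j)"
    using cball_nets[where 'b="'b \<times> real", of "\<bar>b\<bar> + \<rho>"] by blast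
  then obtain F where F: "\<And>j::nat. finite (F j)" "\<And>j. real (card (F j)) \<le> K0 ^ (j + 1)"
    "\<And>j x. x \<in> cball (0::'b \<times> real) (\<bar>b\<bar> + \<rho>) \<Longrightarrow> \<exists>y\<in>F j. dist x y \<le> (1 / 4) ^ j"
    by metis
  define g where "g = (\<lambda>j x. SOME y. y \<in> F j \<and> dist x y \<le> (1 / 4) ^ j)"
  have g: "g j x \<in> F j \<and> dist x (g j x) \<le> (1 / 4) ^ j"
    if "x \<in> cball (0::'b \<times> real) (\<bar>b\<bar> + \<rho>)" for j x
    unfolding g_def by (rule someI_ex) (use F(3)[OF that, of j] in blast)
  \<comment> \<open>The factor \<open>2 * n + 1\<close> covers the choices of E and of the boolean,
    and is at least 1 even for n = 0.\<close>
  define K where "K = real (2 * n + 1) * K0"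
  have K: "1 \<le> K" unfolding K_def using K0 by (simp add: mult_ge1_I)
  \<comment> \<open>A net radius is off by at most h = \<open>(1 / 4) ^ j\<close> and is then
    changed by 2h, so shells have width at most 3h; as h is at most 1, enlarged radii stay below
    \<open>\<rho> + 3\<close>.\<close>
  define C where "C = 3 * shell_const D (\<rho> + 3) DIM('b)"
  have C: "0 \<le> C" unfolding C_def using D \<rho> by (simp add: shell_const_nonneg)
  define c where "c = \<bar>chaining_const C K\<bar> + 1"
  have "\<exists>G\<in>sets (sample_measure N R). 1 - \<delta> \<le> measure (sample_measure N R) G \<and>
       (\<forall>z\<in>G. \<forall>E\<in>\<E>. \<forall>s. \<forall>c'\<in>cball 0 b. \<forall>r\<in>{0..\<rho>}.
          real (card {i\<in>{..<N}. z i \<in> ball_trace m E s c' r})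
            \<le> N * measure R (ball_trace m E s c' r) + c * sqrt (N * ln (1 / \<delta>)))"
    if R: "prob_space R" and m [measurable]: "m \<in> borel_measurable R"
      and bv: "bounded_by_volume D (distr R borel m)"
      and E: "\<E> \<subseteq> sets R" "finite \<E>" "card \<E> \<le> n" and N: "0 < N" and \<delta>: "0 < \<delta>" "\<delta> \<le> 1 / 2"
    for R :: "'a measure" and m :: "'a \<Rightarrow> 'b" and \<E> \<delta> and N :: nat
  proof -
    interpret R: prob_space R by fact
    define T where "T = \<E> \<times> (UNIV :: bool set) \<times> (cball (0::'b) b \<times> {0..\<rho>})"
    define W where "W = (\<lambda>(E, s, c', r). ball_trace m E s c' r)"
    \<comment> \<open>Of the margin of two mesh widths, one covers the error in the centre and one
      that in the radius. For traces outside a ball the removed ball shrinks instead, so the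
      approximation is again from outside; a negative radius becomes 0, which gives the same empty
      ball.\<close>
    define outer where "outer = (\<lambda>j::nat. \<lambda>(E, s, c', r). ball_trace m E s c'
       (if s then r + 2 * (1 / 4) ^ j else max 0 (r - 2 * (1 / 4) ^ j)))"
    define V where "V = (\<lambda>j (E, s, x). outer j (E, s, g j x))"
    have sets: "ball_trace m E s c' r \<in> sets R" if "E \<in> \<E>" for E s c' r
    proof -
      have "E \<in> sets R" using that E by auto
      then have "E = E \<inter> space R" using sets.sets_into_space by blast
      then have "ball_trace m E s c' r = (if s then E \<inter> (m -` ball c' r \<inter> space R) else E - (m -` ball c' r \<inter> space R))"
        unfolding ball_trace_def by auto
      then show ?thesis using \<open>E \<in> sets R\<close> by auto
    qed
    have outer_sets: "outer j (E, s, x) \<in> sets R" if "E \<in> \<E>" for j E s x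
      using that by (cases x) (simp add: outer_def sets)
    have approx: "W p \<subseteq> V j p \<and> measure R (V j p) \<le> measure R (W p) + C * (1 / 4) ^ j"
      if p: "p \<in> T" for p j
    proof -
      obtain E s c' r where p_eq: "p = (E, s, c', r)" "E \<in> \<E>" "c' \<in> cball 0 b" "0 \<le> r" "r \<le> \<rho>"
        using p unfolding T_def by auto
      define h :: real where "h = (1 / 4) ^ j"
      have h: "0 < h" "h \<le> 1" by (auto simp: h_def power_le_one)
      obtain c2 r2 where g_eq: "g j (c', r) = (c2, r2)" by fastforce
      have "norm (c', r) \<le> norm c' + \<bar>r\<bar>"
        using norm_Pair_le[of c' r] by simp
      then have "(c', r) \<in> cball 0 (\<bar>b\<bar> + \<rho>)"
        using p_eq by simp
      from g[OF this, of j] have "dist (c', r) (c2, r2) \<le> h" by (simp add: g_eq h_def)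
      then have near: "dist c' c2 \<le> h" "\<bar>r - r2\<bar> \<le> h"
        using dist_fst_le[of "(c', r)" "(c2, r2)"] dist_snd_le[of "(c', r)" "(c2, r2)"]
        by (auto simp: dist_real_def)
      define big small where "big = (if s then ball c2 (r2 + 2 * h) else ball c' r)"
        and "small = (if s then ball c' r else ball c2 (max 0 (r2 - 2 * h)))"
      have sub: "small \<subseteq> big"
      proof (cases s)
        case True
        then show ?thesis using near h by (auto simp: big_def small_def ball_subset_ball_iff dist_commute)
      next
        case False
        then show ?thesis using near h p_eq(4) by (auto simp: big_def small_def ball_subset_ball_iff dist_commute max_def)
      qed
      have shell: "measure (distr R borel m) (big - small) \<le> C * h"
      proof (cases s)
        case True
        have "measure (distr R borel m) (big - small) \<le> shell_const D (\<rho> + 3) DIM('b) * (r2 + 2 * h - r)"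
          using True sub near h p_eq by (simp add: big_def small_def) (intro measure_shell_le bv D, auto)
        also have "\<dots> \<le> shell_const D (\<rho> + 3) DIM('b) * (3 * h)"
          using near D \<rho> by (intro mult_left_mono) (auto simp: shell_const_nonneg)
        finally show ?thesis by (simp add: C_def)
      next
        case False
        have "measure (distr R borel m) (big - small) \<le> shell_const D (\<rho> + 3) DIM('b) * (r - max 0 (r2 - 2 * h))"
          using False sub near h p_eq by (simp add: big_def small_def) (intro measure_shell_le bv D, auto)
        also have "\<dots> \<le> shell_const D (\<rho> + 3) DIM('b) * (3 * h)"
          using near D \<rho> by (intro mult_left_mono) (auto simp: shell_const_nonneg)
        finally show ?thesis by (simp add: C_def)
      qed
      have Wp: "W p = ball_trace m E s c' r" by (simp add: W_def p_eq)
      have Vp: "V j p = (if s then E \<inter> m -` big else E - m -` small)"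
        by (simp add: V_def outer_def p_eq g_eq big_def small_def ball_trace_def h_def)
      have WV: "W p \<subseteq> V j p"
        unfolding Wp Vp ball_trace_def using sub by (auto simp: big_def small_def)
      have Ein: "E \<subseteq> space R" using p_eq E sets.sets_into_space by blast
      have V_sets: "V j p \<in> sets R"
        unfolding V_def p_eq using outer_sets[OF p_eq(2)] by simp
      have bs: "big - small \<in> sets borel" by (auto simp: big_def small_def)
      \<comment> \<open>The excess of the outer set lies over the shell whatever E is, so one shell
        estimate serves the whole family.\<close>
      have "measure R (V j p) \<le> measure R (W p \<union> (m -` (big - small) \<inter> space R))"
        using bs sets[OF p_eq(2)] Ein unfolding Wp
        by (intro R.finite_measure_mono) (auto simp: Vp ball_trace_def big_def small_def)
      also have "\<dots> \<le> measure R (W p) + measure R (m -` (big - small) \<inter> space R)"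
        using bs sets[OF p_eq(2)] unfolding Wp by (intro measure_Un_le) auto
      also have "measure R (m -` (big - small) \<inter> space R) = measure (distr R borel m) (big - small)"
        using bs by (simp add: measure_distr)
      finally show ?thesis using WV shell unfolding h_def by linarith
    qed
    \<comment> \<open>T is infinite, but \<open>V j\<close> factors through the finite net.\<close>
    have V_im: "V j ` T \<subseteq> outer j ` (\<E> \<times> UNIV \<times> F j)" for j
    proof -
      have "norm (c', r) \<le> \<bar>b\<bar> + \<rho>" if "norm c' \<le> b" "0 \<le> r" "r \<le> \<rho>" for c' :: 'b and r
        using norm_Pair_le[of c' r] that by simp
      then show ?thesis using g unfolding V_def T_def by force
    qed
    have fin_im: "finite (\<E> \<times> (UNIV :: bool set) \<times> F j)" for j
      using E F by auto
    have V_card: "real (card (V j ` T)) \<le> K ^ (j + 1)" for j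
    proof -
      have "card (V j ` T) \<le> card (outer j ` (\<E> \<times> UNIV \<times> F j))"
        using V_im fin_im by (intro card_mono finite_imageI) auto
      also have "\<dots> \<le> card (\<E> \<times> (UNIV :: bool set) \<times> F j)"
        by (rule card_image_le[OF fin_im])
      also have "\<dots> = card \<E> * 2 * card (F j)"
        by (simp add: card_cartesian_product)
      also have "\<dots> \<le> (2 * n + 1) * card (F j)"
        using E by (intro mult_right_mono) auto
      finally have "real (card (V j ` T)) \<le> real (2 * n + 1) * real (card (F j))"
        by (metis of_nat_le_iff of_nat_mult)
      also have "\<dots> \<le> real (2 * n + 1) ^ (j + 1) * K0 ^ (j + 1)"
        using F(2)[of j] self_le_power[of "real (2 * n + 1)" "j + 1"] by (intro mult_mono) auto
      finally show ?thesis unfolding K_def by (simp only: power_mult_distrib)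
    qed
    have "\<exists>G\<in>sets (sample_measure N R). 1 - \<delta> \<le> measure (sample_measure N R) G \<and>
           (\<forall>z\<in>G. \<forall>p\<in>T. real (card {i\<in>{..<N}. z i \<in> W p})
              \<le> N * measure R (W p) + chaining_const C K * sqrt (N * ln (1 / \<delta>)))"
    proof (rule chaining_upper_deviation[where V=V])
      show "V j p \<in> sets R" if "p \<in> T" for j p
        using that by (auto simp: V_def T_def intro!: outer_sets)
      show "W p \<in> sets R" if "p \<in> T" for p
        using that sets unfolding W_def T_def by auto
      show "finite (V j ` T)" for j
        by (rule finite_subset[OF V_im finite_imageI[OF fin_im]])
    qed (use R N \<delta> C K approx V_card in auto)
    then obtain G where G: "G \<in> sets (sample_measure N R)" "1 - \<delta> \<le> measure (sample_measure N R) G"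
      "\<And>z p. z \<in> G \<Longrightarrow> p \<in> T \<Longrightarrow> real (card {i\<in>{..<N}. z i \<in> W p})
              \<le> N * measure R (W p) + chaining_const C K * sqrt (N * ln (1 / \<delta>))" by blast
    have "chaining_const C K * sqrt (N * ln (1 / \<delta>)) \<le> c * sqrt (N * ln (1 / \<delta>))"
      using \<delta> by (intro mult_right_mono) (auto simp: c_def intro!: ln_ge_zero)
    then have "real (card {i\<in>{..<N}. z i \<in> ball_trace m E s c' r})
            \<le> N * measure R (ball_trace m E s c' r) + c * sqrt (N * ln (1 / \<delta>))"
      if "z \<in> G" "E \<in> \<E>" "c' \<in> cball 0 b" "r \<in> {0..\<rho>}" for z E s c' r
      using G(3)[of z "(E, s, c', r)"] that unfolding T_def W_def by simp
    with G(1,2) show ?thesis by blast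
  qed
  then show thesis
    by (rule that[rotated]) (simp_all add: c_def)
qed

subsection \<open>Neighborhoods and the latent mixture component\<close>

text \<open>If all chosen neighbours lie in T', those outside the cluster are covered by T outside
  the cluster and T' - T. Otherwise some chosen s has dh at least r + \<eta>, while every point of T
  has dh below r + \<eta>; so all of T was chosen too, and the prescribed size of S leaves only |Cl
  \<inter> U| - |T| further places.\<close>

lemma neighbors_outside_cluster_le:
  fixes d dh :: "nat \<Rightarrow> nat \<Rightarrow> real" and r :: real
  assumes U: "finite U" and S: "nearest_neighbors dh U u (card (Cl \<inter> U)) S"
    and approx: "\<And>i. i \<in> U \<Longrightarrow> \<bar>dh u i - d u i\<bar> \<le> \<eta>" and \<eta>: "0 \<le> \<eta>"
  defines "T \<equiv> {i\<in>U. d u i < r}" and "T' \<equiv> {i\<in>U. d u i < r + 2 * \<eta>}"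
  shows "real (card (S - Cl)) \<le> real (card (T - Cl)) +
           max (real (card T') - real (card T)) (real (card (Cl \<inter> U)) - real (card T))"
proof -
  have SU: "S \<subseteq> U" and Scard: "card S = card (Cl \<inter> U)"
    and near: "\<And>s t. s \<in> S \<Longrightarrow> t \<in> U - S \<Longrightarrow> dh u s \<le> dh u t"
    using S unfolding nearest_neighbors_def by auto
  have fin: "finite S" "finite T" "finite T'"
    using U SU unfolding T_def T'_def by (auto intro: finite_subset)
  have TT': "T \<subseteq> T'" using \<eta> unfolding T_def T'_def by auto
  have *: "real (card (S - Cl)) \<le> real (card (T - Cl)) + (real (card X) - real (card T))"
    if X: "finite X" "T \<subseteq> X" "S \<subseteq> X" for X
  proof -
    have "card (S - Cl) \<le> card ((T - Cl) \<union> (X - T))"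
      using X fin by (intro card_mono) auto
    also have "\<dots> \<le> card (T - Cl) + card (X - T)"
      by (rule card_Un_le)
    also have "card (X - T) = card X - card T"
      using X fin by (intro card_Diff_subset) auto
    finally have "card (S - Cl) \<le> card (T - Cl) + (card X - card T)" .
    moreover have "card T \<le> card X" using X by (intro card_mono) auto
    ultimately show ?thesis by linarith
  qed
  show ?thesis
  proof (cases "S \<subseteq> T'")
    case True
    then show ?thesis using *[OF fin(3) TT'] by linarith
  next
    case False
    then obtain s where s: "s \<in> S" "s \<notin> T'" by auto
    have "T \<subseteq> S"
    proof
      fix i assume i: "i \<in> T"
      show "i \<in> S"
      proof (rule ccontr)
        assume "i \<notin> S"
        then have "dh u s \<le> dh u i" using near[OF s(1), of i] i by (auto simp: T_def)
        moreover have "dh u i < r + \<eta>" using approx[of i] i by (auto simp: T_def)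
        moreover have "r + \<eta> \<le> dh u s" using approx[of s] s SU by (auto simp: T'_def)
        ultimately show False by linarith
      qed
    qed
    show ?thesis using *[OF fin(1) \<open>T \<subseteq> S\<close> subset_refl] unfolding Scard by linarith
  qed
qed

text \<open>The density bound makes the mass of a ball Lipschitz in its radius. It rises from 0 to 1
  on \<open>[0, 2 * b + 1]\<close>, so the mass of the cluster is attained there, on a closed set of
  radii that contains its infimum. The extra 1 lets the open ball cover all of
  \<open>cball 0 b\<close>.\<close>

lemma gn_radius_attained:
  fixes Q :: "'b::euclidean_space measure" and l :: "'b \<Rightarrow> nat"
  assumes Q: "prob_space Q" and sets_Q [measurable_cong]: "sets Q = sets borel"
    and D: "bounded_by_volume D Q" "0 \<le> D"
    and supp: "measure Q (cball 0 b) = 1" and b: "0 \<le> b" and m: "norm m \<le> b"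
  obtains r where "0 \<le> r" "r \<le> 2 * b + 1" "gn_radius l Q m = ereal r"
    "measure Q (ball m r) = measure Q (cluster l m)"
proof -
  interpret Q: prob_space Q by fact
  define f where "f = (\<lambda>r. measure Q (ball m r))"
  define \<rho> where "\<rho> = 2 * b + 1"
  define A where "A = shell_const D \<rho> DIM('b)"
  have \<rho>: "0 \<le> \<rho>" using b by (simp add: \<rho>_def)
  have A: "0 \<le> A" unfolding A_def using D \<rho> by (simp add: shell_const_nonneg)
  have lip: "\<bar>f s - f r\<bar> \<le> A * \<bar>s - r\<bar>" if "0 \<le> r" "r \<le> s" "s \<le> \<rho>" for r s
  proof -
    have sub: "ball m r \<subseteq> ball m s" using that by auto
    have "f s - f r = measure Q (ball m s - ball m r)"
      unfolding f_def using sub by (intro Q.finite_measure_Diff[symmetric]) auto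
    moreover have "\<dots> \<le> A * (s - r)"
      unfolding A_def by (intro measure_shell_le D sub that)
    ultimately show ?thesis using that measure_nonneg[of Q "ball m s - ball m r"] by linarith
  qed
  have "A-lipschitz_on {0..\<rho>} f"
  proof (rule lipschitz_onI)
    fix x y assume "x \<in> {0..\<rho>}" "y \<in> {0..\<rho>}"
    then show "dist (f x) (f y) \<le> A * dist x y"
      using lip[of x y] lip[of y x] by (cases "x \<le> y") (auto simp: dist_real_def abs_minus_commute)
  qed (rule A)
  then have cont: "continuous_on {0..\<rho>} f" by (rule lipschitz_on_continuous_on)
  define y where "y = measure Q (cluster l m)"
  have "f \<rho> = 1"
  proof -
    have "cball 0 b \<subseteq> ball m \<rho>"
    proof
      fix x :: 'b assume "x \<in> cball 0 b"
      then show "x \<in> ball m \<rho>"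
        using norm_triangle_ineq4[of m x] m b by (simp add: dist_norm \<rho>_def)
    qed
    then have "1 \<le> f \<rho>"
      unfolding f_def supp[symmetric] by (intro Q.finite_measure_mono) auto
    then show ?thesis using Q.prob_le_1[of "ball m \<rho>"] by (simp add: f_def)
  qed
  moreover have "f 0 = 0" by (simp add: f_def)
  ultimately obtain r1 where r1: "0 \<le> r1" "r1 \<le> \<rho>" "f r1 = y"
    using IVT'[of f 0 y \<rho>] \<rho> cont Q.prob_le_1[of "cluster l m"] by (auto simp: y_def)
  define S where "S = {r\<in>{0..\<rho>}. f r = y}"
  have "closed S"
    unfolding S_def by (rule continuous_closed_preimage_constant[OF cont]) auto
  moreover have S_ne: "S \<noteq> {}" using r1 by (auto simp: S_def)
  moreover have S_bdd: "bdd_below S" by (auto simp: S_def intro: bdd_belowI[of _ 0])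
  ultimately have r0: "Inf S \<in> S" by (intro closed_contains_Inf)
  have "gn_radius l Q m = ereal (Inf S)"
    unfolding gn_radius_def
  proof (rule Inf_eqI)
    fix i assume "i \<in> {ereal r |r. 0 \<le> r \<and> measure Q (ball m r) = measure Q (cluster l m)}"
    then obtain r where r: "i = ereal r" "0 \<le> r" "f r = y" by (auto simp: f_def y_def)
    have "Inf S \<le> r"
    proof (cases "r \<le> \<rho>")
      case True
      then show ?thesis using r S_bdd by (intro cInf_lower) (auto simp: S_def)
    next
      case False
      then show ?thesis using r0 by (auto simp: S_def)
    qed
    then show "ereal (Inf S) \<le> i" using r by simp
  next
    fix e :: ereal assume "\<And>i. i \<in> {ereal r |r. 0 \<le> r \<and> measure Q (ball m r) = measure Q (cluster l m)} \<Longrightarrow> e \<le> i"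
    then show "e \<le> ereal (Inf S)" using r0 by (auto simp: S_def f_def y_def)
  qed
  then show ?thesis
    using r0 by (intro that[of "Inf S"]) (auto simp: S_def f_def y_def \<rho>_def)
qed

text \<open>The component of the mixture is kept as a boolean, since it selects the subset \<open>U'\<close> in the finite
  good neighborhood property.\<close>

definition labelled_mixture ::
  "real \<Rightarrow> 'b::topological_space measure \<Rightarrow> 'b measure \<Rightarrow> (bool \<times> 'b) measure" where
  "labelled_mixture \<nu> Q1 Q2 =
     distr (measure_pmf (bernoulli_pmf (1 - \<nu>)) \<Otimes>\<^sub>M (Q1 \<Otimes>\<^sub>M Q2)) (count_space UNIV \<Otimes>\<^sub>M borel)
       (\<lambda>(s, x, y). (s, if s then x else y))"

section \<open>The law of the labelled mixture\<close>

context
  fixes \<nu> :: real and Q1 Q2 :: "'b::euclidean_space measure"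
  assumes \<nu>: "0 \<le> \<nu>" "\<nu> \<le> 1"
    and Q1: "prob_space Q1" "sets Q1 = sets borel" and Q2: "prob_space Q2" "sets Q2 = sets borel"
begin

lemma labelled_mixture_measurable:
  "(\<lambda>(s, x, y). (s, if s then x else y))
     \<in> measure_pmf (bernoulli_pmf (1 - \<nu>)) \<Otimes>\<^sub>M (Q1 \<Otimes>\<^sub>M Q2) \<rightarrow>\<^sub>M count_space UNIV \<Otimes>\<^sub>M borel"
proof -
  note [measurable_cong] = Q1(2) Q2(2)
  have [measurable]: "Measurable.pred (measure_pmf (bernoulli_pmf (1 - \<nu>)) \<Otimes>\<^sub>M (Q1 \<Otimes>\<^sub>M Q2)) fst"
    by (rule measurable_compose[OF measurable_fst]) simp
  show ?thesis
    unfolding split_beta by measurable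
qed

lemma prob_space_labelled_mixture: "prob_space (labelled_mixture \<nu> Q1 Q2)"
proof -
  interpret Q1: prob_space Q1 by (rule Q1)
  interpret Q2: prob_space Q2 by (rule Q2)
  interpret A: pair_prob_space Q1 Q2 ..
  interpret B: pair_prob_space "measure_pmf (bernoulli_pmf (1 - \<nu>))" "Q1 \<Otimes>\<^sub>M Q2" ..
  show ?thesis
    unfolding labelled_mixture_def by (intro B.prob_space_distr labelled_mixture_measurable)
qed

lemma sets_labelled_mixture [measurable_cong]:
  "sets (labelled_mixture \<nu> Q1 Q2) = sets (count_space UNIV \<Otimes>\<^sub>M borel)"
  by (simp add: labelled_mixture_def)

lemma measure_labelled_mixture:
  assumes A: "A \<in> sets borel"
  shows "measure (labelled_mixture \<nu> Q1 Q2) ({s} \<times> A)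
           = (if s then (1 - \<nu>) * measure Q1 A else \<nu> * measure Q2 A)"
proof -
  interpret Q1: prob_space Q1 by (rule Q1)
  interpret Q2: prob_space Q2 by (rule Q2)
  interpret A: pair_prob_space Q1 Q2 ..
  let ?B = "measure_pmf (bernoulli_pmf (1 - \<nu>))"
  have sp: "space Q1 = UNIV" "space Q2 = UNIV"
    using sets_eq_imp_space_eq[OF Q1(2)] sets_eq_imp_space_eq[OF Q2(2)] by simp_all
  have A': "A \<in> sets Q1" "A \<in> sets Q2" "UNIV \<in> sets Q1" "UNIV \<in> sets Q2" 
    using A Q1 Q2 by auto
  have "measure (labelled_mixture \<nu> Q1 Q2) ({s} \<times> A) =
      measure (?B \<Otimes>\<^sub>M (Q1 \<Otimes>\<^sub>M Q2)) ({s} \<times> (if s then A \<times> UNIV else UNIV \<times> A))"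
    unfolding labelled_mixture_def using A
    by (subst measure_distr[OF labelled_mixture_measurable])
       (auto simp: space_pair_measure sp intro!: arg_cong[where f="measure _"])
  also have "\<dots> = measure ?B {s} * measure (Q1 \<Otimes>\<^sub>M Q2) (if s then A \<times> UNIV else UNIV \<times> A)"
    using A' unfolding measure_def
    by (subst A.emeasure_pair_measure_Times) (auto simp: enn2real_mult)
  also have "measure (Q1 \<Otimes>\<^sub>M Q2) (if s then A \<times> UNIV else UNIV \<times> A) = (if s then measure Q1 A else measure Q2 A)"
    using A' Q1.emeasure_space_1 Q2.emeasure_space_1 unfolding measure_def
    by (auto simp: Q2.emeasure_pair_measure_Times enn2real_mult sp)
  also have "measure ?B {s} = (if s then 1 - \<nu> else \<nu>)"
    using \<nu> by (simp add: measure_pmf_single)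
  finally show ?thesis by simp
qed

lemma distr_snd_labelled_mixture:
  assumes Q: "prob_space Q" "sets Q = sets borel"
    and mix: "\<And>S. S \<in> sets borel \<Longrightarrow> measure Q S = (1 - \<nu>) * measure Q1 S + \<nu> * measure Q2 S"
  shows "distr (labelled_mixture \<nu> Q1 Q2) borel snd = Q"
proof (rule measure_eqI)
  interpret R: prob_space "labelled_mixture \<nu> Q1 Q2" by (rule prob_space_labelled_mixture)
  interpret Q: prob_space Q by (rule Q)
  fix A assume "A \<in> sets (distr (labelled_mixture \<nu> Q1 Q2) borel snd)"
  then have A: "A \<in> sets borel" by simp
  have sp: "space (labelled_mixture \<nu> Q1 Q2) = UNIV"
    by (simp add: labelled_mixture_def space_pair_measure)
  have "measure (labelled_mixture \<nu> Q1 Q2) (snd -` A) = measure (labelled_mixture \<nu> Q1 Q2) ({True} \<times> A \<union> {False} \<times> A)"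
    by (intro arg_cong[where f="measure _"]) auto
  also have "\<dots> = measure (labelled_mixture \<nu> Q1 Q2) ({True} \<times> A) + measure (labelled_mixture \<nu> Q1 Q2) ({False} \<times> A)"
    using A by (intro R.finite_measure_Union) (auto simp: sets_labelled_mixture)
  also have "\<dots> = measure Q A"
    using A by (simp add: measure_labelled_mixture mix)
  finally show "emeasure (distr (labelled_mixture \<nu> Q1 Q2) borel snd) A = emeasure Q A"
    using A by (simp add: emeasure_distr sp R.emeasure_eq_measure Q.emeasure_eq_measure)
qed (use Q in simp)

end

text \<open>The projection of a measurable event that forgets the labels is measurable because there are
  only finitely many label sequences.\<close>

lemma project_event:
  fixes R :: "('s::finite \<times> 'b::topological_space) measure"
  assumes R: "prob_space R" and sets_R [measurable_cong]: "sets R = sets (count_space UNIV \<Otimes>\<^sub>M borel)"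
    and G: "G \<in> sets (sample_measure N R)"
  shows "\<exists>G'\<in>sets (\<Pi>\<^sub>M i\<in>{..<N}. borel).
           measure (sample_measure N R) G \<le> measure (sample_measure N (distr R borel snd)) G' \<and>
           (\<forall>m\<in>G'. \<exists>z\<in>G. \<forall>i<N. snd (z i) = m i)"
proof -
  define lift :: "(nat \<Rightarrow> 's) \<Rightarrow> (nat \<Rightarrow> 'b) \<Rightarrow> nat \<Rightarrow> 's \<times> 'b"
    where "lift s m = (\<lambda>i\<in>{..<N}. (s i, m i))" for s m
  have R_snd [measurable]: "snd \<in> R \<rightarrow>\<^sub>M borel" by measurable
  have spR: "space R = UNIV" using sets_eq_imp_space_eq[OF sets_R] by (simp add: space_pair_measure)
  have lift_m [measurable]: "lift s \<in> (\<Pi>\<^sub>M i\<in>{..<N}. borel) \<rightarrow>\<^sub>M (sample_measure N R)" for s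
    unfolding lift_def by (intro measurable_restrict) (auto simp: measurable_cong_sets[OF refl sets_R])
  define G' where "G' = (\<Union>s\<in>{..<N} \<rightarrow>\<^sub>E UNIV. lift s -` G \<inter> space (\<Pi>\<^sub>M i\<in>{..<N}. borel))"
  have G'_sets: "G' \<in> sets (\<Pi>\<^sub>M i\<in>{..<N}. borel)"
    unfolding G'_def using G by (intro sets.finite_UN finite_PiE measurable_sets[OF lift_m]) auto
  have proj: "compose {..<N} snd \<in> (sample_measure N R) \<rightarrow>\<^sub>M (\<Pi>\<^sub>M i\<in>{..<N}. borel)"
    unfolding compose_def by (intro measurable_restrict) auto
  interpret P: prob_space "sample_measure N R" by (intro prob_space_PiM R)
  \<comment> \<open>A point mass is a probability measure on the Borel sets, as the rule for images
    of products demands of the target; only its sigma-algebra matters for the image measure.\<close>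
  define x0 :: 'b where "x0 = undefined"
  have "distr (sample_measure N R) (\<Pi>\<^sub>M i\<in>{..<N}. return borel x0) (compose {..<N} snd)
      = (\<Pi>\<^sub>M i\<in>{..<N}. distr R (return borel x0) snd)"
    by (rule distr_PiM_finite_prob_space') (auto intro: R prob_space_return)
  moreover have "sets (\<Pi>\<^sub>M i\<in>{..<N}. return borel x0) = sets (\<Pi>\<^sub>M i\<in>{..<N}. borel)"
    by (intro sets_PiM_cong) auto
  moreover have "distr R (return borel x0) snd = distr R borel snd"
    by (rule distr_cong) auto
  ultimately have D: "distr (sample_measure N R) (\<Pi>\<^sub>M i\<in>{..<N}. borel) (compose {..<N} snd)
      = (sample_measure N (distr R borel snd))"
    by (simp cong: distr_cong)
  have "G \<subseteq> compose {..<N} snd -` G' \<inter> space (sample_measure N R)"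
  proof
    fix z assume z: "z \<in> G"
    then have zsp: "z \<in> space (sample_measure N R)" using G sets.sets_into_space by blast
    then have "lift (restrict (\<lambda>i. fst (z i)) {..<N}) (compose {..<N} snd z) = z"
      by (intro ext) (auto simp: lift_def compose_def space_PiM PiE_def extensional_def)
    moreover have "compose {..<N} snd z \<in> space (\<Pi>\<^sub>M i\<in>{..<N}. borel)"
      using measurable_space[OF proj zsp] .
    ultimately have "compose {..<N} snd z \<in> G'"
      unfolding G'_def using z by (intro UN_I[of "restrict (\<lambda>i. fst (z i)) {..<N}"]) auto
    then show "z \<in> compose {..<N} snd -` G' \<inter> space (sample_measure N R)" using zsp by auto
  qed
  then have "measure (sample_measure N R) G \<le> measure (sample_measure N R) (compose {..<N} snd -` G' \<inter> space (sample_measure N R))"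
    using G'_sets proj by (intro P.finite_measure_mono) auto
  also have "\<dots> = measure (sample_measure N (distr R borel snd)) G'"
    unfolding D[symmetric] using G'_sets proj by (simp add: measure_distr)
  finally have "measure (sample_measure N R) G \<le> measure (sample_measure N (distr R borel snd)) G'" .
  moreover have "\<exists>z\<in>G. \<forall>i<N. snd (z i) = m i" if "m \<in> G'" for m
    using that unfolding G'_def by (fastforce simp: lift_def)
  ultimately show ?thesis using G'_sets by blast
qed

text \<open>The absolute value keeps the constant nonnegative for every real D: the final constant
  is fixed before any density is known to exist.\<close>

lemma bounded_density_bounded_by_volume:
  assumes "bounded_density D Q"
  shows "bounded_by_volume \<bar>D\<bar> Q"
  unfolding bounded_by_volume_def
proof (intro ballI impI)
  fix S :: "(real, 'a) vec set" assume S: "S \<in> sets borel" "bounded S"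
  obtain f where f [measurable]: "f \<in> borel_measurable borel" and fD: "\<And>m. 0 \<le> f m \<and> f m \<le> D"
    and Q: "Q = density lborel (\<lambda>m. ennreal (f m))"
    using assms unfolding bounded_density_def by auto
  have "0 \<le> D" using fD[of undefined] by linarith
  have fin: "emeasure lborel S < \<infinity>"
    using S emeasure_bounded_finite by auto
  have "emeasure Q S = (\<integral>\<^sup>+ m. ennreal (f m) * indicator S m \<partial>lborel)"
    unfolding Q using S by (subst emeasure_density) auto
  also have "\<dots> \<le> (\<integral>\<^sup>+ m. ennreal D * indicator S m \<partial>lborel)"
    by (intro nn_integral_mono mult_right_mono ennreal_leI) (auto simp: fD)
  also have "\<dots> = ennreal D * emeasure lborel S"
    using S by (simp add: nn_integral_cmult_indicator)
  also have "\<dots> = ennreal (D * measure lborel S)"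
    using fin \<open>0 \<le> D\<close> by (simp add: emeasure_eq_ennreal_measure ennreal_mult)
  finally have "measure Q S \<le> D * measure lborel S"
    unfolding measure_def[of Q] using \<open>0 \<le> D\<close> by (intro enn2real_leI) auto
  then show "measure Q S \<le> \<bar>D\<bar> * measure lborel S"
    using \<open>0 \<le> D\<close> by simp
qed

lemma good_neighborhood_mono:
  assumes "good_neighborhood N d lab a v" "a \<le> a'"
  shows "good_neighborhood N d lab a' v"
proof -
  have "a * N \<le> a' * N" using assms by (intro mult_right_mono) auto
  then show ?thesis using assms(1) unfolding good_neighborhood_def by (meson order_trans)
qed

lemma good_neighborhood_trivial:
  assumes "1 \<le> v"
  shows "good_neighborhood N d lab a v"
proof -
  have "(1 - v) * N \<le> 0" using assms by (simp add: mult_nonpos_nonneg)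
  then show ?thesis unfolding good_neighborhood_def by (intro exI[of _ "{}"]) auto
qed

text \<open>The radius r equalises the masses of ball and cluster, so up to an error of 3e the ball
  holds as many points of U as the cluster. The enlarged ball has at most 3e points more, apart from
  a shell of mass of order \<gamma>, and at most N \<alpha> + e points of the ball lie outside the
  cluster. The neighbour estimate adds these to N \<alpha> + 4e + c \<gamma> N.\<close>

lemma sample_good_neighborhood:
  fixes b D :: real and k :: nat
  assumes D: "0 \<le> D" and b: "0 \<le> b"
  obtains c where "0 < c" and "\<And>(l :: 'b::euclidean_space \<Rightarrow> nat) (Q :: 'b measure) \<alpha> \<nu> \<delta> (N :: nat).
     prob_space Q \<Longrightarrow> sets Q = sets borel \<Longrightarrow> l \<in> borel \<rightarrow>\<^sub>M count_space {1..k} \<Longrightarrow>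
     good_neighborhood_dist l \<alpha> \<nu> Q \<Longrightarrow> bounded_by_volume D Q \<Longrightarrow> measure Q (cball 0 b) = 1 \<Longrightarrow>
     0 < N \<Longrightarrow> 0 < \<delta> \<Longrightarrow> \<delta> \<le> 1 / 2 \<Longrightarrow>
     \<exists>G\<in>sets (sample_measure N borel). 1 - \<delta> \<le> measure (sample_measure N Q) G \<and>
       (\<forall>m\<in>G. (\<forall>i<N. norm (m i) \<le> b) \<longrightarrow>
         (\<forall>\<gamma> mh. 0 \<le> \<gamma> \<longrightarrow> (\<forall>i<N. dist (mh i) (m i) \<le> \<gamma>) \<longrightarrow>
            good_neighborhood N (\<lambda>i j. dist (mh i) (mh j)) (\<lambda>i. l (m i))
              (\<alpha> + deviation c N \<delta> + c * \<gamma>) (\<nu> + deviation c N \<delta>)))"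
proof -
  \<comment> \<open>Radii of at most \<open>2 * b + 1\<close>, enlarged by 4 \<gamma> in the only
    relevant case \<gamma> \<le> 1.\<close>
  define \<rho> where "\<rho> = 2 * b + 5"
  have \<rho>: "0 \<le> \<rho>" using b by (simp add: \<rho>_def)
  obtain c0 where c0: "0 < c0" and dev: "\<And>(R :: (bool \<times> 'b) measure) (m :: bool \<times> 'b \<Rightarrow> 'b) \<E> \<delta> (N :: nat).
    prob_space R \<Longrightarrow> m \<in> borel_measurable R \<Longrightarrow> bounded_by_volume D (distr R borel m) \<Longrightarrow>
    \<E> \<subseteq> sets R \<Longrightarrow> finite \<E> \<Longrightarrow> card \<E> \<le> 2 * k + 3 \<Longrightarrow> 0 < N \<Longrightarrow> 0 < \<delta> \<Longrightarrow> \<delta> \<le> 1 / 2 \<Longrightarrow>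
    \<exists>G\<in>sets (sample_measure N R). 1 - \<delta> \<le> measure (sample_measure N R) G \<and>
       (\<forall>z\<in>G. \<forall>E\<in>\<E>. \<forall>s. \<forall>c'\<in>cball 0 b. \<forall>r\<in>{0..\<rho>}.
          real (card {i\<in>{..<N}. z i \<in> ball_trace m E s c' r})
            \<le> N * measure R (ball_trace m E s c' r) + c0 * sqrt (N * ln (1 / \<delta>)))"
    by (rule uniform_ball_deviation[OF D \<rho>, where n = "2 * k + 3" and b = b]) (rule that)
  define A where "A = shell_const D \<rho> DIM('b)"
  have A: "0 \<le> A" unfolding A_def using D \<rho> by (simp add: shell_const_nonneg)
  \<comment> \<open>\<open>4 * c0\<close> for the four errors e, \<open>4 * A\<close> for a shell of
    width 4 \<gamma>, and 1 to make the claim trivial for \<gamma> > 1.\<close>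
  define c where "c = 4 * c0 + 4 * A + 1"
  have c: "0 < c" "1 \<le> c" "4 * c0 \<le> c" "4 * A \<le> c" using c0 A by (auto simp: c_def)
  have "\<exists>G\<in>sets (sample_measure N borel). 1 - \<delta> \<le> measure (sample_measure N Q) G \<and>
       (\<forall>m\<in>G. (\<forall>i<N. norm (m i) \<le> b) \<longrightarrow>
         (\<forall>\<gamma> mh. 0 \<le> \<gamma> \<longrightarrow> (\<forall>i<N. dist (mh i) (m i) \<le> \<gamma>) \<longrightarrow>
            good_neighborhood N (\<lambda>i j. dist (mh i) (mh j)) (\<lambda>i. l (m i))
              (\<alpha> + deviation c N \<delta> + c * \<gamma>) (\<nu> + deviation c N \<delta>)))"
    if Q: "prob_space Q" "sets Q = sets borel" and l: "l \<in> borel \<rightarrow>\<^sub>M count_space {1..k}"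
      and gn: "good_neighborhood_dist l \<alpha> \<nu> Q" and bv: "bounded_by_volume D Q"
      and supp: "measure Q (cball 0 b) = 1" and N: "0 < N" and \<delta>: "0 < \<delta>" "\<delta> \<le> 1 / 2"
    for l :: "'b \<Rightarrow> nat" and Q :: "'b measure" and \<alpha> \<nu> \<delta> :: real and N :: nat
  proof -
    interpret Q: prob_space Q by fact
    define L where "L = ln (1 / \<delta>)"
    have L: "0 < L" unfolding L_def using \<delta> by simp
    define s where "s = sqrt (1 / N * L)"
    have s: "0 < s" using L N by (simp add: s_def)
    have sN: "sqrt (N * L) = N * s"
    proof -
      have "real N * L = (real N)\<^sup>2 * (1 / N * L)" using N by (simp add: power2_eq_square)
      then show ?thesis unfolding s_def by (simp only: real_sqrt_mult) simp
    qed
    have devN: "deviation c N \<delta> = c * s" by (simp add: deviation_def s_def L_def)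
    obtain Q1 Q2 where \<nu>: "0 \<le> \<nu>" "\<nu> \<le> 1" and Q1: "prob_space Q1" "sets Q1 = sets borel"
      and Q2: "prob_space Q2" "sets Q2 = sets borel"
      and mix: "\<And>S. S \<in> sets borel \<Longrightarrow> measure Q S = (1 - \<nu>) * measure Q1 S + \<nu> * measure Q2 S"
      and nb: "\<And>m'. measure Q1 ({m. ereal (dist m' m) < gn_radius l Q1 m'} - cluster l m') \<le> \<alpha>"
      using gn unfolding good_neighborhood_dist_def by blast
    interpret Q1: prob_space Q1 by fact
    have \<alpha>: "0 \<le> \<alpha>" using nb[of 0] measure_nonneg order_trans by blast
    show ?thesis
    proof (cases "\<nu> = 1")
      \<comment> \<open>Q then carries no mass of \<open>Q1\<close>, so nothing is known about the
        density or support of that component; but the noise level now exceeds 1, which admits the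
        empty set of good points.\<close>
      case True
      have "good_neighborhood N d lab a (\<nu> + deviation c N \<delta>)" for d lab a
        using True c s by (intro good_neighborhood_trivial) (simp add: devN)
      moreover have "measure (sample_measure N Q) (space (sample_measure N borel)) = 1"
      proof -
        interpret P: prob_space "sample_measure N Q" by (intro prob_space_PiM Q)
        have "space (sample_measure N borel) = space (sample_measure N Q)"
          using sets_eq_imp_space_eq[OF Q(2)] by (simp add: space_PiM)
        then show ?thesis using P.prob_space by simp
      qed
      ultimately show ?thesis
        using \<delta> by (intro bexI[of _ "space (sample_measure N borel)"]) auto
    next
      case False
      then have \<nu>1: "0 < 1 - \<nu>" using \<nu> by simp
      have Q1_le: "(1 - \<nu>) * measure Q1 S \<le> measure Q S" if "S \<in> sets borel" for S
        using mix[OF that] \<nu> by simp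
      \<comment> \<open>This bound degenerates as \<nu> tends to 1. It serves only to show that the
        radius is attained and never enters c.\<close>
      have Q1_bv: "bounded_by_volume (D / (1 - \<nu>)) Q1"
        unfolding bounded_by_volume_def
      proof (intro ballI impI)
        fix S :: "'b set" assume S: "S \<in> sets borel" "bounded S"
        then have "(1 - \<nu>) * measure Q1 S \<le> D * measure lborel S"
          using bv Q1_le[OF S(1)] unfolding bounded_by_volume_def by (meson order_trans)
        then show "measure Q1 S \<le> D / (1 - \<nu>) * measure lborel S"
          using \<nu>1 by (simp add: pos_le_divide_eq mult.commute)
      qed
      have Q1_supp: "measure Q1 (cball 0 b) = 1"
      proof -
        have "(1 - \<nu>) * (1 - measure Q1 (cball 0 b)) = (1 - \<nu>) * measure Q1 (- cball 0 b)"
          using Q1.prob_compl[of "cball 0 b"] Q1 sets_eq_imp_space_eq[OF Q1(2)]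
          by (simp add: Compl_eq_Diff_UNIV)
        also have "\<dots> \<le> measure Q (- cball 0 b)" by (intro Q1_le) auto
        also have "\<dots> = 0"
          using Q.prob_compl[of "cball 0 b"] Q supp sets_eq_imp_space_eq[OF Q(2)]
          by (simp add: Compl_eq_Diff_UNIV)
        finally show ?thesis
          using \<nu>1 Q1.prob_le_1[of "cball 0 b"] by (simp add: mult_le_0_iff)
      qed
      define R where "R = labelled_mixture \<nu> Q1 Q2"
      note mixture = \<nu> Q1 Q2
      have R: "prob_space R" and sets_R [measurable_cong]: "sets R = sets (count_space UNIV \<Otimes>\<^sub>M borel)"
        unfolding R_def by (rule prob_space_labelled_mixture[OF mixture] sets_labelled_mixture[OF mixture])+
      have R_snd: "distr R borel snd = Q"
        unfolding R_def by (rule distr_snd_labelled_mixture[OF mixture Q mix])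
      have snd_R: "snd \<in> borel_measurable R" by measurable
      have RT: "measure R ({True} \<times> S) = (1 - \<nu>) * measure Q1 S"
        and RF: "measure R ({False} \<times> S) = \<nu> * measure Q2 S" if "S \<in> sets borel" for S
        unfolding R_def by (simp_all add: measure_labelled_mixture[OF mixture that])
      have l_sets: "l -` {y} \<in> sets borel" for y
      proof -
        have "l x \<in> {1..k}" for x using measurable_space[OF l, of x] by simp
        then have "l -` {y} = l -` ({y} \<inter> {1..k}) \<inter> space borel" by auto
        also have "\<dots> \<in> sets borel" by (rule measurable_sets[OF l]) simp
        finally show ?thesis .
      qed
      have l_range: "1 \<le> l x" "l x \<le> k" for x using measurable_space[OF l, of x] by simp_all
      \<comment> \<open>One noise event, k + 1 label events and their k + 1 complements: the
        \<open>2 * k + 3\<close> in \<open>dev\<close>.\<close>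
      define \<E> :: "(bool \<times> 'b) set set" where
        "\<E> = insert ({False} \<times> UNIV) ((\<lambda>y. {True} \<times> l -` {y}) ` {..k} \<union> (\<lambda>y. {True} \<times> (- (l -` {y}))) ` {..k})"
      have \<E>_sets: "\<E> \<subseteq> sets R" unfolding \<E>_def sets_R using l_sets by auto
      have \<E>_card: "card \<E> \<le> 2 * k + 3"
      proof -
        have "card \<E> \<le> Suc (card ((\<lambda>y. {True} \<times> l -` {y}) ` {..k} \<union> (\<lambda>y. {True} \<times> (- (l -` {y}))) ` {..k}))"
          unfolding \<E>_def by (rule card_insert_le_m1) auto
        also have "\<dots> \<le> Suc (card ((\<lambda>y. {True} \<times> l -` {y}) ` {..k}) + card ((\<lambda>y. {True} \<times> (- (l -` {y}))) ` {..k}))"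
          by (simp add: card_Un_le)
        also have "\<dots> \<le> Suc (card {..k} + card {..k})"
          by (intro Suc_le_mono[THEN iffD2] add_mono card_image_le) auto
        finally show ?thesis by simp
      qed
      have "finite \<E>" by (simp add: \<E>_def)
      with dev[OF R snd_R, unfolded R_snd, OF bv \<E>_sets _ \<E>_card N \<delta>]
      obtain G where G: "G \<in> sets (sample_measure N R)" "1 - \<delta> \<le> measure (sample_measure N R) G"
        and G_dev: "\<And>z E t c' r. z \<in> G \<Longrightarrow> E \<in> \<E> \<Longrightarrow> c' \<in> cball (0::'b) b \<Longrightarrow> r \<in> {0..\<rho>} \<Longrightarrow>
          real (card {i\<in>{..<N}. z i \<in> ball_trace snd E t c' r})
            \<le> N * measure R (ball_trace snd E t c' r) + c0 * (N * s)"
        unfolding sN[unfolded L_def] by blast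
      obtain G' where G': "G' \<in> sets (sample_measure N borel)"
        "measure (sample_measure N R) G \<le> measure (sample_measure N Q) G'"
        and lift: "\<And>m. m \<in> G' \<Longrightarrow> \<exists>z\<in>G. \<forall>i<N. snd (z i) = m i"
        using project_event[OF R sets_R G(1)] unfolding R_snd by blast
      have "good_neighborhood N (\<lambda>i j. dist (mh i) (mh j)) (\<lambda>i. l (m i))
              (\<alpha> + deviation c N \<delta> + c * \<gamma>) (\<nu> + deviation c N \<delta>)"
        if m: "m \<in> G'" "\<And>i. i < N \<Longrightarrow> norm (m i) \<le> b" and \<gamma>: "0 \<le> \<gamma>"
          and near: "\<And>i. i < N \<Longrightarrow> dist (mh i) (m i) \<le> \<gamma>" for m mh :: "nat \<Rightarrow> 'b" and \<gamma>
      proof -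
        \<comment> \<open>The labels are not observed; for m in \<open>G'\<close> some good labelled
          sample lies above m, and its labels supply the witness U.\<close>
        obtain z where z: "z \<in> G" "\<And>i. i < N \<Longrightarrow> snd (z i) = m i" using lift[OF m(1)] by blast
        define e where "e = c0 * (N * s)"
        define U where "U = {i\<in>{..<N}. fst (z i)}"
        define cnt where "cnt = (\<lambda>S. real (card {i\<in>U. m i \<in> S}))"
        define P where "P = (\<lambda>S. (1 - \<nu>) * measure Q1 S)"
        have U: "finite U" "U \<subseteq> {..<N}" by (auto simp: U_def)
        have cntT: "real (card {i\<in>{..<N}. z i \<in> {True} \<times> S}) = cnt S" for S
          unfolding cnt_def U_def using z(2)
          by (intro arg_cong[where f=real] arg_cong[where f=card]) (auto simp: mem_Times_iff)
        have F: "cnt S \<le> N * P S + e"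
          if "ball_trace snd E t x r = {True} \<times> S" "E \<in> \<E>" "S \<in> sets borel" "norm x \<le> b" "0 \<le> r" "r \<le> \<rho>"
          for E t x r S
          using G_dev[OF z(1) that(2), of x r t] that(4-6)
          unfolding that(1) cntT RT[OF that(3)] P_def e_def by simp
        have F_noise: "real (card ({..<N} - U)) \<le> N * \<nu> + e"
        proof -
          have "{False} \<times> UNIV \<in> \<E>" by (simp add: \<E>_def)
          \<comment> \<open>A ball of radius 0 is empty, so the trace outside it is the whole
            event.\<close>
          from G_dev[OF z(1) this, of 0 0 False] have
            "real (card {i\<in>{..<N}. z i \<in> {False} \<times> UNIV}) \<le> N * measure R ({False} \<times> UNIV) + e"
            using b \<rho> by (simp add: ball_trace_def e_def)
          moreover have "measure Q2 UNIV = 1"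
            using prob_space.prob_space[OF Q2(1)] sets_eq_imp_space_eq[OF Q2(2)] by simp
          moreover have "{i\<in>{..<N}. z i \<in> {False} \<times> UNIV} = {..<N} - U"
            by (auto simp: U_def mem_Times_iff)
          ultimately show ?thesis by (simp add: RF)
        qed
        have cntU: "real (card U) + real (card ({..<N} - U)) = N"
          using card_Diff_subset[OF U] card_mono[OF finite_lessThan U(2)] by simp
        have F_cluster: "cnt (l -` {y}) \<le> N * P (l -` {y}) + e" if "y \<le> k" for y
        proof -
          have "{True} \<times> l -` {y} \<in> \<E>" using that by (auto simp: \<E>_def)
          then show ?thesis
            using b \<rho> l_sets by (intro F[of "{True} \<times> l -` {y}" False 0 0]) (auto simp: ball_trace_def)
        qed
        have F_out: "cnt (ball x r - l -` {y}) \<le> N * P (ball x r - l -` {y}) + e"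
          if "y \<le> k" "norm x \<le> b" "0 \<le> r" "r \<le> \<rho>" for x y r
        proof -
          have E: "{True} \<times> (- (l -` {y})) \<in> \<E>" using that by (auto simp: \<E>_def)
          have "ball_trace snd ({True} \<times> (- (l -` {y}))) True x r = {True} \<times> (ball x r - l -` {y})"
            by (auto simp: ball_trace_def)
          from F[OF this E _ that(2-4)] show ?thesis using l_sets by auto
        qed
        have F_all: "cnt (ball x r) \<le> N * P (ball x r) + e" "cnt (- ball x r) \<le> N * P (- ball x r) + e"
          if "norm x \<le> b" "0 \<le> r" "r \<le> \<rho>" for x r
        proof -
          \<comment> \<open>Labels start at 1, so label 0 gives an empty event, whose complement
            supplies the whole well-clustered component.\<close>
          have "l x \<noteq> 0" for x using l_range(1)[of x] by linarith
          then have "l -` {0} = {}" by blast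
          moreover have "{True} \<times> (- (l -` {0})) \<in> \<E>" by (auto simp: \<E>_def)
          ultimately have E: "{True} \<times> UNIV \<in> \<E>" by simp
          have "ball_trace snd ({True} \<times> UNIV) True x r = {True} \<times> ball x r"
            by (auto simp: ball_trace_def)
          from F[OF this E _ that] show "cnt (ball x r) \<le> N * P (ball x r) + e" by auto
          have "ball_trace snd ({True} \<times> UNIV) False x r = {True} \<times> (- ball x r)"
            by (auto simp: ball_trace_def)
          from F[OF this E _ that] show "cnt (- ball x r) \<le> N * P (- ball x r) + e" by auto
        qed
        \<comment> \<open>The points in the ball are those of U minus those outside. One e is lost
          in the size of U, through the noise count, and one in the count outside the ball.\<close>
        have F_ball: "N * P (ball x r) - 2 * e \<le> cnt (ball x r)"
          if "norm x \<le> b" "0 \<le> r" "r \<le> \<rho>" for x r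
        proof -
          have "card U = card {i\<in>U. m i \<in> ball x r} + card {i\<in>U. m i \<in> - ball x r}"
            using U by (subst card_Un_disjoint[symmetric]) (auto intro!: arg_cong[where f=card])
          then have "real (card U) = cnt (ball x r) + cnt (- ball x r)"
            by (simp add: cnt_def)
          moreover have "measure Q1 (- ball x r) = 1 - measure Q1 (ball x r)"
            using Q1.prob_compl[of "ball x r"] Q1 sets_eq_imp_space_eq[OF Q1(2)]
            by (simp add: Compl_eq_Diff_UNIV)
          then have "P (- ball x r) = 1 - \<nu> - P (ball x r)"
            unfolding P_def by (simp only:) (simp add: algebra_simps)
          then have "N * P (- ball x r) = N - N * \<nu> - N * P (ball x r)"
            by (simp only: right_diff_distrib mult_1_right)
          ultimately show ?thesis
            using F_all(2)[OF that] F_noise cntU by linarith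
        qed
        have e_le: "4 * e \<le> deviation c N \<delta> * N" "e \<le> deviation c N \<delta> * N"
        proof -
          have "4 * c0 * (N * s) \<le> c * (N * s)"
            using c s by (intro mult_right_mono) auto
          then show "4 * e \<le> deviation c N \<delta> * N" by (simp add: e_def devN algebra_simps)
          moreover have "0 \<le> e" using c0 s by (simp add: e_def)
          ultimately show "e \<le> deviation c N \<delta> * N" by linarith
        qed
        have dev_nonneg: "0 \<le> deviation c N \<delta>" using c s by (simp add: devN)
        show ?thesis
          unfolding good_neighborhood_def
        proof (intro exI[of _ U] conjI ballI allI impI)
          show "U \<subseteq> {..<N}" by (rule U)
          show "(1 - (\<nu> + deviation c N \<delta>)) * real N \<le> real (card U)"
            using F_noise cntU e_le by (simp add: algebra_simps)
          fix u S assume u: "u \<in> U" and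
            S: "nearest_neighbors (\<lambda>i j. dist (mh i) (mh j)) U u (card (cluster (\<lambda>i. l (m i)) u \<inter> U)) S"
          have uN: "u < N" using u U by auto
          define Cl where "Cl = cluster (\<lambda>i. l (m i)) u"
          have SU: "S \<subseteq> U" using S by (simp add: nearest_neighbors_def)
          show "real (card (S - cluster (\<lambda>i. l (m i)) u)) \<le> (\<alpha> + deviation c N \<delta> + c * \<gamma>) * real N"
          proof (cases "\<gamma> \<le> 1")
            case False
            have "card (S - cluster (\<lambda>i. l (m i)) u) \<le> card {..<N}"
              using SU U by (intro card_mono) auto
            then have "real (card (S - cluster (\<lambda>i. l (m i)) u)) \<le> 1 * real N" by simp
            also have "1 \<le> c * \<gamma>" using False c mult_mono[of 1 c 1 \<gamma>] by simp
            then have "1 * real N \<le> (\<alpha> + deviation c N \<delta> + c * \<gamma>) * real N"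
              using \<alpha> dev_nonneg by (intro mult_right_mono) auto
            finally show ?thesis .
          next
            case True
            have mu: "norm (m u) \<le> b" using m(2) uN .
            obtain r where r: "0 \<le> r" "r \<le> 2 * b + 1" "gn_radius l Q1 (m u) = ereal r"
              "measure Q1 (ball (m u) r) = measure Q1 (cluster l (m u))"
              using gn_radius_attained[OF Q1 Q1_bv _ Q1_supp b mu] D \<nu>1 by auto
            define y where "y = l (m u)"
            have y: "y \<le> k" unfolding y_def by (rule l_range)
            have cl: "cluster l (m u) = l -` {y}" by (auto simp: cluster_def y_def)
            define B where "B = ball (m u) r"
            \<comment> \<open>Distances between estimates differ from the true ones by at most 2
              \<gamma>, and the neighbour estimate enlarges the radius by twice that.\<close>
            define B' where "B' = ball (m u) (r + 2 * (2 * \<gamma>))"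
            have r\<rho>: "r \<le> \<rho>" "r + 2 * (2 * \<gamma>) \<le> \<rho>" using r True by (auto simp: \<rho>_def)
            have "P (B - l -` {y}) \<le> \<alpha>"
            proof -
              have "{x. ereal (dist (m u) x) < gn_radius l Q1 (m u)} = B"
                by (auto simp: r B_def)
              then have "measure Q1 (B - l -` {y}) \<le> \<alpha>" using nb[of "m u"] by (simp add: cl)
              moreover have "P (B - l -` {y}) \<le> 1 * measure Q1 (B - l -` {y})"
                unfolding P_def using \<nu> by (intro mult_right_mono) auto
              ultimately show ?thesis by simp
            qed
            then have 1: "cnt (B - l -` {y}) \<le> N * \<alpha> + e"
              using F_out[OF y mu r(1) r\<rho>(1)] unfolding B_def
              by (smt (verit) mult_left_mono of_nat_0_le_iff)
            have 2: "cnt (l -` {y}) \<le> N * P B + e"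
              using F_cluster[OF y] r(4) by (simp add: B_def P_def cl)
            have 3: "N * P B - 2 * e \<le> cnt B"
              unfolding B_def by (rule F_ball[OF mu r(1) r\<rho>(1)])
            have "P B' - P B \<le> A * (4 * \<gamma>)"
            proof -
              have sub: "B \<subseteq> B'" using \<gamma> by (auto simp: B_def B'_def)
              have "P B' - P B = (1 - \<nu>) * measure Q1 (B' - B)"
                using sub Q1(2) by (subst Q1.finite_measure_Diff) (auto simp: B_def B'_def P_def algebra_simps)
              \<comment> \<open>Passing to Q keeps the shell constant A independent of
                \<nu>.\<close>
              also have "\<dots> \<le> measure Q (B' - B)"
                by (intro Q1_le) (auto simp: B_def B'_def)
              also have "\<dots> \<le> A * (r + 2 * (2 * \<gamma>) - r)"
                unfolding B_def B'_def A_def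
                using sub r \<gamma> r\<rho> by (intro measure_shell_le bv D) (auto simp: B_def B'_def)
              finally show ?thesis by simp
            qed
            also have "\<dots> \<le> c * \<gamma>"
              using c(4) \<gamma> mult_right_mono[of "4 * A" c \<gamma>] by (simp add: algebra_simps)
            finally have "N * (P B' - P B) \<le> N * (c * \<gamma>)" by (intro mult_left_mono) auto
            then have 4: "cnt B' \<le> N * P B + N * (c * \<gamma>) + e"
              using F_all(1)[OF mu _ r\<rho>(2)] r \<gamma> unfolding B'_def by (simp add: algebra_simps)
            have approx: "\<bar>dist (mh u) (mh i) - dist (m u) (m i)\<bar> \<le> 2 * \<gamma>" if "i \<in> U" for i
            proof -
              have "i < N" using that U by auto
              then show ?thesis
                using near[of i] near[OF uN] dist_triangle[of "mh u" "mh i" "m u"]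
                  dist_triangle[of "m u" "mh i" "m i"] dist_triangle[of "m u" "m i" "mh u"]
                  dist_triangle[of "mh u" "m i" "mh i"]
                by (simp add: dist_commute)
            qed
            have "real (card (S - Cl)) \<le> real (card ({i\<in>U. dist (m u) (m i) < r} - Cl)) +
               max (real (card {i\<in>U. dist (m u) (m i) < r + 2 * (2 * \<gamma>)}) - real (card {i\<in>U. dist (m u) (m i) < r}))
                   (real (card (Cl \<inter> U)) - real (card {i\<in>U. dist (m u) (m i) < r}))"
              using neighbors_outside_cluster_le[OF U(1) S, of "\<lambda>i j. dist (m i) (m j)" "2 * \<gamma>" r] approx \<gamma>
              by (simp add: Cl_def)
            moreover have "{i\<in>U. dist (m u) (m i) < r} - Cl = {i\<in>U. m i \<in> B - l -` {y}}"
              "{i\<in>U. dist (m u) (m i) < r} = {i\<in>U. m i \<in> B}"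
              "{i\<in>U. dist (m u) (m i) < r + 2 * (2 * \<gamma>)} = {i\<in>U. m i \<in> B'}"
              "Cl \<inter> U = {i\<in>U. m i \<in> l -` {y}}"
              by (auto simp: B_def B'_def Cl_def cluster_def y_def)
            ultimately have "real (card (S - Cl)) \<le> cnt (B - l -` {y}) + max (cnt B' - cnt B) (cnt (l -` {y}) - cnt B)"
              by (simp only: cnt_def)
            moreover have "0 \<le> N * (c * \<gamma>)" using c \<gamma> by simp
            ultimately have "real (card (S - Cl)) \<le> N * \<alpha> + 4 * e + N * (c * \<gamma>)"
              using 1 2 3 4 by linarith
            then show ?thesis using e_le by (simp add: Cl_def algebra_simps)
          qed
        qed
      qed
      then show ?thesis
        using G G' by (intro bexI[of _ G']) auto
    qed
  qed
  then show thesis by (rule that[OF c(1)])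
qed

subsection \<open>Perturbed samples and the clustering algorithm\<close>

text \<open>Needed because \<open>cluster\<close> ranges over all indices, whereas the restricted
  sample has the true labels only below N.\<close>

lemma good_neighborhood_cong:
  assumes "\<And>i. i < N \<Longrightarrow> lab i = lab' i"
  shows "good_neighborhood N d lab a v = good_neighborhood N d lab' a v"
proof -
  have "cluster lab u \<inter> U = cluster lab' u \<inter> U" "S - cluster lab u = S - cluster lab' u"
    if "U \<subseteq> {..<N}" "u \<in> U" "nearest_neighbors d U u r S" for U S u r
    using that assms by (auto simp: cluster_def nearest_neighbors_def subset_iff)
  moreover have "cluster lab u \<inter> U = cluster lab' u \<inter> U" if "U \<subseteq> {..<N}" "u \<in> U" for U u
    using that assms by (auto simp: cluster_def subset_iff)
  ultimately show ?thesis
    unfolding good_neighborhood_def by (intro ex_cong1 conj_cong ball_cong all_cong1) auto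
qed

text \<open>The sum over treatments dominates the l1 norm of the error, hence its Euclidean norm.
  Finiteness matters because \<open>enn2real\<close> sends infinity to 0.\<close>

lemma dist_le_sup_error:
  fixes \<mu> \<mu>h :: "'x \<Rightarrow> real^'q::finite"
  assumes x: "x \<in> S" and fin: "sup_error S \<mu>h \<mu> < \<infinity>"
  shows "dist (\<mu>h x) (\<mu> x) \<le> enn2real (sup_error S \<mu>h \<mu>)"
proof -
  have "ennreal (dist (\<mu>h x) (\<mu> x)) \<le> ennreal (\<Sum>a\<in>UNIV. \<bar>\<mu>h x $ a - \<mu> x $ a\<bar>)"
    unfolding dist_norm using norm_le_l1_cart[of "\<mu>h x - \<mu> x"] by (intro ennreal_leI) simp
  also have "\<dots> = (\<Sum>a\<in>UNIV. ennreal \<bar>\<mu>h x $ a - \<mu> x $ a\<bar>)"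
    by simp
  also have "\<dots> \<le> sup_error S \<mu>h \<mu>"
    unfolding sup_error_def sup_norm_def using x by (intro sum_mono SUP_upper2[of x]) auto
  finally show ?thesis
    using enn2real_mono[of "ennreal (dist (\<mu>h x) (\<mu> x))"] fin by simp
qed

lemma epsilon_ge:
  assumes "0 < c" "0 \<le> \<gamma>" "0 < N" "0 < \<delta>" "\<delta> < 1"
  shows "c * \<gamma> \<le> epsilon c N \<delta> \<gamma>"
proof -
  have "0 \<le> 1 / N * ln (1 / \<delta>)" using assms by simp
  moreover have "0 \<le> sqrt (\<gamma> / N * ln (1 / \<gamma>))" if "0 < \<gamma>" "\<gamma> < 1"
    using that by simp
  ultimately show ?thesis
    unfolding epsilon_def using assms by (intro mult_left_mono) auto
qed

lemma deviation_pos: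
  assumes "0 < c" "0 < N" "0 < \<delta>" "\<delta> < 1"
  shows "0 < deviation c N \<delta>"
  using assms by (simp add: deviation_def)

lemma good_neighborhood_dist_nonneg:
  assumes "good_neighborhood_dist l \<alpha> \<nu> Q"
  shows "0 \<le> \<alpha>" "0 \<le> \<nu>"
  using assms measure_nonneg order_trans unfolding good_neighborhood_dist_def by blast+

text \<open>No measurability of \<open>E\<close> is needed, since the lower bound only integrates a multiple of the
  indicator of \<open>W\<close>.\<close>

lemma sampling_prob_ge:
  assumes M: "prob_space M" and W: "W \<in> sets M" "1 - \<delta>' \<le> measure M W"
    and \<delta>: "0 \<le> \<delta>" "\<delta> \<le> 1" "0 \<le> \<delta>'" "\<delta>' \<le> 1"
    and E: "AE w in M. w \<in> W \<longrightarrow> 1 - \<delta> \<le> measure_pmf.prob (random_subset N (n w)) {S. E w S}"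
  shows "ennreal (1 - \<delta> - \<delta>') \<le> sampling_prob M N n E"
proof -
  interpret prob_space M by fact
  have "1 - \<delta> - \<delta>' \<le> (1 - \<delta>) * (1 - \<delta>')"
    using \<delta> by (simp add: algebra_simps)
  also have "\<dots> \<le> (1 - \<delta>) * measure M W"
    using W \<delta> by (intro mult_left_mono) auto
  finally have "ennreal (1 - \<delta> - \<delta>') \<le> ennreal ((1 - \<delta>) * measure M W)"
    by (rule ennreal_leI)
  also have "\<dots> = (\<integral>\<^sup>+ w. ennreal (1 - \<delta>) * indicator W w \<partial>M)"
    using W \<delta> by (simp add: nn_integral_cmult_indicator emeasure_eq_measure ennreal_mult)
  also have "\<dots> \<le> sampling_prob M N n E"
    unfolding sampling_prob_def
  proof (rule nn_integral_mono_AE)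
    show "AE w in M. ennreal (1 - \<delta>) * indicator W w
            \<le> emeasure (measure_pmf (random_subset N (n w))) {S. E w S}"
      using E by eventually_elim
        (auto simp: measure_pmf.emeasure_eq_measure indicator_def intro!: ennreal_leI)
  qed
  finally show ?thesis .
qed

text \<open>The constant comes from the sample event alone, before the law and the algorithm are
  given. For almost every sample in that event the guarantee of the algorithm applies with the
  sample-dependent tolerance \<open>\<alpha>' + \<epsilon> w\<close> and size \<open>n w\<close>,
  and only the draw of the subset is still random; integrating over the event multiplies the two
  probabilities.\<close>

theorem theorem3p2:
  fixes B D :: real and k :: nat
  shows "\<exists>c>0.
    \<forall>(M :: 'w measure) (MX :: 'x measure) (P :: ('x \<times> 'q::finite \<times> real) measure)
      (\<mu> :: 'x \<Rightarrow> real^'q) (l :: real^'q \<Rightarrow> nat) (Q :: (real^'q) measure) (\<alpha> :: real) (\<nu> :: real)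
      (N :: nat) (Z :: nat \<Rightarrow> 'w \<Rightarrow> 'x \<times> 'q \<times> real) (\<mu>h :: 'w \<Rightarrow> 'x \<Rightarrow> real^'q)
      (\<theta>1 :: real) (\<theta>2 :: real) (alg :: clustering_algorithm)
      (\<delta> :: real) (\<delta>N :: real) (n :: 'w \<Rightarrow> nat).
      let X = (\<lambda>i w. fst (Z i w));
          PX = distr P MX fst;
          \<gamma> = (\<lambda>w. sup_error (space MX) (\<mu>h w) \<mu>);
          \<alpha>' = \<alpha> + deviation c N \<delta>N;
          \<nu>' = \<nu> + deviation c N \<delta>N;
          \<epsilon> = (\<lambda>w. epsilon c N \<delta>N (enn2real (\<gamma> w)));
          lab = (\<lambda>w i. l (\<mu> (X i w)));
          d = (\<lambda>w i j. dist (\<mu>h w (X i w)) (\<mu>h w (X j w)))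
      in
      prob_space M \<and>
      outcome_regression MX P \<mu> \<and>
      iid_sample M P {..<N} Z \<and>
      l \<in> borel \<rightarrow>\<^sub>M count_space {1..k} \<and>
      Q = distr PX borel \<mu> \<and>
      good_neighborhood_dist l \<alpha> \<nu> Q \<and>
      ((\<exists>F. Donsker PX F \<and> (\<forall>a. (\<lambda>x. \<mu> x $ a) \<in> F) \<and> (AE w in M. \<forall>a. (\<lambda>x. \<mu>h w x $ a) \<in> F))
        \<or> separate_sample_estimator M P N Z \<mu>h) \<and>
      (AE x in PX. norm (\<mu> x) \<le> B) \<and>
      (AE w in M. AE x in PX. norm (\<mu>h w x) \<le> B) \<and>
      bounded_density D Q \<and>
      0 < \<theta>1 \<and> \<theta>1 \<le> \<theta>2 \<and> inductive_robust_hierarchical \<theta>1 \<theta>2 alg \<and>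
      0 < \<delta> \<and> \<delta> < 1 \<and> 0 < \<delta>N \<and> \<delta>N < 1 \<and>
      (AE w in M. n w < N) \<and>
      (AE w in M. \<gamma> w < \<infinity> \<longrightarrow> subset_size \<theta>1 \<theta>2 (\<alpha>' + \<epsilon> w) \<nu>' \<delta> (n w))
      \<longrightarrow>
      ennreal (1 - \<delta> - 2 * \<delta>N) \<le>
        sampling_prob M N n
          (\<lambda>w S. \<gamma> w < \<infinity> \<and> real (min_cluster_size N (lab w)) > 12 * (\<nu>' + \<alpha>' + \<epsilon> w) * N
             \<longrightarrow> good_output N (lab w) (\<nu>' + \<delta>) (alg (\<alpha>' + \<epsilon> w) \<nu>' N (d w) S))"
proof -
  define b where "b = \<bar>B\<bar>"
  have b: "0 \<le> b" by (simp add: b_def)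
  obtain c where c: "0 < c" and sample: "\<And>(l :: real^'q \<Rightarrow> nat) (Q :: (real^'q) measure) \<alpha> \<nu> \<delta> (N :: nat).
     prob_space Q \<Longrightarrow> sets Q = sets borel \<Longrightarrow> l \<in> borel \<rightarrow>\<^sub>M count_space {1..k} \<Longrightarrow>
     good_neighborhood_dist l \<alpha> \<nu> Q \<Longrightarrow> bounded_by_volume \<bar>D\<bar> Q \<Longrightarrow> measure Q (cball 0 b) = 1 \<Longrightarrow>
     0 < N \<Longrightarrow> 0 < \<delta> \<Longrightarrow> \<delta> \<le> 1 / 2 \<Longrightarrow>
     \<exists>G\<in>sets (sample_measure N borel). 1 - \<delta> \<le> measure (sample_measure N Q) G \<and>
       (\<forall>m\<in>G. (\<forall>i<N. norm (m i) \<le> b) \<longrightarrow>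
         (\<forall>\<gamma> mh. 0 \<le> \<gamma> \<longrightarrow> (\<forall>i<N. dist (mh i) (m i) \<le> \<gamma>) \<longrightarrow>
            good_neighborhood N (\<lambda>i j. dist (mh i) (mh j)) (\<lambda>i. l (m i))
              (\<alpha> + deviation c N \<delta> + c * \<gamma>) (\<nu> + deviation c N \<delta>)))"
    by (rule sample_good_neighborhood[OF abs_ge_zero b, where k = k]) (rule that)
  show ?thesis
  proof (intro exI[of _ c] conjI allI, rule c, unfold Let_def, intro impI, elim conjE)
    fix M :: "'w measure" and MX :: "'x measure" and P :: "('x \<times> 'q \<times> real) measure"
      and \<mu> :: "'x \<Rightarrow> real^'q" and l :: "real^'q \<Rightarrow> nat" and Q :: "(real^'q) measure"
      and \<alpha> \<nu> :: real and N :: nat and Z :: "nat \<Rightarrow> 'w \<Rightarrow> 'x \<times> 'q \<times> real"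
      and \<mu>h :: "'w \<Rightarrow> 'x \<Rightarrow> real^'q" and \<theta>1 \<theta>2 :: real and alg :: clustering_algorithm
      and \<delta> \<delta>N :: real and n :: "'w \<Rightarrow> nat"
    let ?\<gamma> = "\<lambda>w. sup_error (space MX) (\<mu>h w) \<mu>"
    let ?a = "\<lambda>w. \<alpha> + deviation c N \<delta>N + epsilon c N \<delta>N (enn2real (?\<gamma> w))"
    let ?v = "\<nu> + deviation c N \<delta>N"
    assume M: "prob_space M" and reg: "outcome_regression MX P \<mu>" and iid: "iid_sample M P {..<N} Z"
      and l: "l \<in> borel \<rightarrow>\<^sub>M count_space {1..k}" and Q: "Q = distr (distr P MX fst) borel \<mu>"
      and gn: "good_neighborhood_dist l \<alpha> \<nu> Q"
      and bnd: "AE x in distr P MX fst. norm (\<mu> x) \<le> B" and dens: "bounded_density D Q"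
      and alg: "inductive_robust_hierarchical \<theta>1 \<theta>2 alg"
      and \<delta>: "0 < \<delta>" "\<delta> < 1" "0 < \<delta>N" "\<delta>N < 1" and nN: "AE w in M. n w < N"
      and size: "AE w in M. ?\<gamma> w < \<infinity> \<longrightarrow> subset_size \<theta>1 \<theta>2 (?a w) ?v \<delta> (n w)"
    interpret M: prob_space M by fact
    have P: "prob_space P" and sets_P [measurable_cong]: "sets P = sets (MX \<Otimes>\<^sub>M (count_space UNIV \<Otimes>\<^sub>M borel))"
      and \<mu> [measurable]: "\<mu> \<in> MX \<rightarrow>\<^sub>M borel"
      using reg unfolding outcome_regression_def by blast+
    have fst_P [measurable]: "fst \<in> P \<rightarrow>\<^sub>M MX" by measurable
    define f where "f = (\<lambda>z :: 'x \<times> 'q \<times> real. \<mu> (fst z))"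
    have f [measurable]: "f \<in> P \<rightarrow>\<^sub>M borel" unfolding f_def by measurable
    have Q_f: "Q = distr P borel f"
      unfolding Q by (subst distr_distr) (auto simp: f_def comp_def)
    have Q_prob: "prob_space Q" unfolding Q_f by (rule prob_space.prob_space_distr[OF P f])
    have indep: "M.indep_vars (\<lambda>_. P) Z {..<N}" and law: "\<And>i. i < N \<Longrightarrow> distr M P (Z i) = P"
      using iid unfolding iid_sample_def by auto
    have Z_m: "Z i \<in> M \<rightarrow>\<^sub>M P" if "i < N" for i
      using M.indep_vars_def indep that by (auto simp: M.indep_vars_def)
    show "ennreal (1 - \<delta> - 2 * \<delta>N) \<le> sampling_prob M N n
          (\<lambda>w S. ?\<gamma> w < \<infinity> \<and> 12 * (?v + (\<alpha> + deviation c N \<delta>N) + epsilon c N \<delta>N (enn2real (?\<gamma> w))) * real N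
               < real (min_cluster_size N (\<lambda>i. l (\<mu> (fst (Z i w)))))
             \<longrightarrow> good_output N (\<lambda>i. l (\<mu> (fst (Z i w)))) (?v + \<delta>)
                  (alg (?a w) ?v N (\<lambda>i j. dist (\<mu>h w (fst (Z i w))) (\<mu>h w (fst (Z j w)))) S))"
      (is "_ \<le> sampling_prob M N n ?E")
    proof (cases "\<delta>N \<le> 1 / 2")
      \<comment> \<open>The claimed lower bound is then at most 0.\<close>
      case False
      then have "1 - \<delta> - 2 * \<delta>N \<le> 0" using \<delta> by simp
      then show ?thesis by (simp add: ennreal_neg)
    next
      case True
      have N: "0 < N"
      proof -
        have "AE w in M. 0 < N" using nN by eventually_elim auto
        then show ?thesis using M.AE_const by simp
      qed
      define m where "m = (\<lambda>w. \<lambda>i\<in>{..<N}. f (Z i w))"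
      have fZ: "(\<lambda>w. f (Z i w)) \<in> borel_measurable M" if "i < N" for i
        using measurable_compose[OF Z_m[OF that] f] .
      have law_f: "distr M borel (\<lambda>w. f (Z i w)) = Q" if "i < N" for i
        using distr_distr[OF f Z_m[OF that]] unfolding Q_f law[OF that] comp_def by simp
      have "M.indep_vars (\<lambda>_. borel) (\<lambda>i w. f (Z i w)) {..<N}"
        by (rule M.indep_vars_compose2[OF indep]) (rule f)
      then have "distr M (sample_measure N borel) m = (\<Pi>\<^sub>M i\<in>{..<N}. distr M borel (\<lambda>w. f (Z i w)))"
        unfolding m_def using N fZ by (subst (asm) M.indep_vars_iff_distr_eq_PiM') auto
      also have "\<dots> = sample_measure N Q"
        by (intro PiM_cong) (auto simp: law_f)
      finally have law_m: "distr M (sample_measure N borel) m = sample_measure N Q" .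
      have m_meas: "m \<in> M \<rightarrow>\<^sub>M sample_measure N borel"
        unfolding m_def using fZ by (intro measurable_restrict) auto
      have bnd_P: "AE z in P. norm (f z) \<le> b"
      proof -
        have "AE z in P. norm (\<mu> (fst z)) \<le> B" by (rule AE_distrD[OF fst_P bnd])
        then show ?thesis by eventually_elim (simp add: f_def b_def)
      qed
      \<comment> \<open>The conclusion on the sample event assumes that all points have norm at most
        b, which holds almost surely but perhaps not for every w.\<close>
      have bnd_M: "AE w in M. \<forall>i\<in>{..<N}. norm (f (Z i w)) \<le> b"
      proof (rule AE_finite_allI)
        fix i assume "i \<in> {..<N}"
        then have i: "i < N" by simp
        show "AE w in M. norm (f (Z i w)) \<le> b"
          using AE_distrD[OF Z_m[OF i]] bnd_P unfolding law[OF i] by blast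
      qed simp
      have supp: "measure Q (cball 0 b) = 1"
      proof -
        interpret P: prob_space P by fact
        have "measure Q (cball 0 b) = measure P (f -` cball 0 b \<inter> space P)"
          unfolding Q_f by (intro measure_distr) auto
        also have "\<dots> = 1"
          using bnd_P by (subst P.prob_eq_1) (auto elim!: eventually_mono)
        finally show ?thesis .
      qed
      have sQ: "sets Q = sets borel" by (simp add: Q)
      obtain G where G: "G \<in> sets (sample_measure N borel)" "1 - \<delta>N \<le> measure (sample_measure N Q) G"
        and G_good: "\<And>m \<gamma> mh. m \<in> G \<Longrightarrow> (\<forall>i<N. norm (m i) \<le> b) \<Longrightarrow> 0 \<le> \<gamma> \<Longrightarrow>
            (\<forall>i<N. dist (mh i) (m i) \<le> \<gamma>) \<Longrightarrow>
            good_neighborhood N (\<lambda>i j. dist (mh i) (mh j)) (\<lambda>i. l (m i))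
              (\<alpha> + deviation c N \<delta>N + c * \<gamma>) ?v"
        using sample[OF Q_prob sQ l gn bounded_density_bounded_by_volume[OF dens] supp N \<delta>(3) True]
        by blast
      define W where "W = m -` G \<inter> space M"
      have W: "W \<in> sets M" unfolding W_def by (rule measurable_sets[OF m_meas G(1)])
      have "measure (sample_measure N Q) G = measure M W"
        unfolding W_def law_m[symmetric] by (rule measure_distr[OF m_meas G(1)])
      then have W_prob: "1 - \<delta>N \<le> measure M W" using G by simp
      have good: "1 - \<delta> \<le> measure_pmf.prob (random_subset N (n w)) {S. ?E w S}"
        if w: "w \<in> W" "\<forall>i\<in>{..<N}. norm (f (Z i w)) \<le> b" and nw: "n w < N"
          and size_w: "?\<gamma> w < \<infinity> \<longrightarrow> subset_size \<theta>1 \<theta>2 (?a w) ?v \<delta> (n w)" for w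
      proof (cases "?\<gamma> w < \<infinity> \<and> 12 * (?v + (\<alpha> + deviation c N \<delta>N) + epsilon c N \<delta>N (enn2real (?\<gamma> w))) * real N
               < real (min_cluster_size N (\<lambda>i. l (\<mu> (fst (Z i w)))))")
        \<comment> \<open>The event is then an implication with a false premise, true for every
          subset.\<close>
        case False
        then have "{S. ?E w S} = UNIV" by auto
        then show ?thesis using \<delta> by simp
      next
        case True
        let ?d = "\<lambda>i j. dist (\<mu>h w (fst (Z i w))) (\<mu>h w (fst (Z j w)))"
        let ?lab = "\<lambda>i. l (\<mu> (fst (Z i w)))"
        let ?g = "enn2real (?\<gamma> w)"
        have wM: "w \<in> space M" and mG: "m w \<in> G" using w by (auto simp: W_def)
        have near: "dist (\<mu>h w (fst (Z i w))) (m w i) \<le> ?g" if i: "i < N" for i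
        proof -
          have "fst (Z i w) \<in> space MX"
            using measurable_space[OF fst_P measurable_space[OF Z_m[OF i] wM]] .
          from dist_le_sup_error[OF this conjunct1[OF True]] show ?thesis
            using i by (simp add: m_def f_def)
        qed
        have "good_neighborhood N ?d (\<lambda>i. l (m w i)) (\<alpha> + deviation c N \<delta>N + c * ?g) ?v"
          by (rule G_good[OF mG]) (use w near in \<open>auto simp: m_def\<close>)
        then have "good_neighborhood N ?d (\<lambda>i. l (m w i)) (?a w) ?v"
          by (rule good_neighborhood_mono) (use epsilon_ge[of c ?g N \<delta>N] c N \<delta> in auto)
        also have "good_neighborhood N ?d (\<lambda>i. l (m w i)) (?a w) ?v = good_neighborhood N ?d ?lab (?a w) ?v"
          by (rule good_neighborhood_cong) (simp add: m_def f_def)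
        finally have gnN: "good_neighborhood N ?d ?lab (?a w) ?v" .
        \<comment> \<open>Strict because \<open>\<delta>N < 1\<close>; it makes both parameters
          positive, as the guarantee of the algorithm asks, even if \<alpha> and \<nu>
          vanish.\<close>
        have "0 < deviation c N \<delta>N" by (rule deviation_pos) (use c N \<delta> in auto)
        moreover have "0 \<le> epsilon c N \<delta>N ?g"
          using epsilon_ge[of c ?g N \<delta>N] c N \<delta> by (auto intro: order_trans[rotated])
        ultimately have av: "0 < ?a w" "0 < ?v"
          using good_neighborhood_dist_nonneg[OF gn] by auto
        have "1 - \<delta> \<le> measure_pmf.prob (random_subset N (n w))
            {S. good_output N ?lab (?v + \<delta>) (alg (?a w) ?v N ?d S)}"
          using alg[unfolded inductive_robust_hierarchical_def, rule_format, of "?a w" ?v \<delta> "n w" N ?d ?lab]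
            av \<delta> nw size_w True gnN
          by (simp add: dissimilarity_def dist_commute add.assoc)
        also have "\<dots> \<le> measure_pmf.prob (random_subset N (n w)) {S. ?E w S}"
          by (intro measure_pmf.finite_measure_mono) auto
        finally show ?thesis .
      qed
      have "AE w in M. w \<in> W \<longrightarrow> 1 - \<delta> \<le> measure_pmf.prob (random_subset N (n w)) {S. ?E w S}"
        using bnd_M nN size by eventually_elim (rule impI, rule good)
      then have "ennreal (1 - \<delta> - \<delta>N) \<le> sampling_prob M N n ?E"
        using \<delta> by (intro sampling_prob_ge[OF M W W_prob]) auto
      moreover have "ennreal (1 - \<delta> - 2 * \<delta>N) \<le> ennreal (1 - \<delta> - \<delta>N)"
        using \<delta> by (intro ennreal_leI) simp
      ultimately show ?thesis by (rule order_trans[rotated])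
    qed
  qed
qed

end
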